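(* Let $(k_1,\dots,k_n) \in \mathbb{Z}_{\geq 1}^n$ and $m = k_1 + \dots + k_n$. The triple $(\widetilde{\mathcal{G}}([(k_1,\dots,k_n)]), \widetilde{\phi}, (g_1, \dots, g_m))$ is a $[(k_1,\dots,k_n)]$-expansion group. If $(G, \phi, (h_1, \dots, h_m))$ is any $[(k_1,\dots,k_n)]$-expansion group, then there is a unique epimorphism of $[(k_1,\dots,k_n)]$-expansion groups $\widetilde{\mathcal{G}}([(k_1,\dots,k_n)]) \twoheadrightarrow G$ (sending $g_j \mapsto h_j$). In particular $\#G \leq 2^{m \cdot 2^{n-1} - 2^n + n + 1}$, with equality if and only if this map is an isomorphism.
   Context: $V_{[m]} = \mathbb{F}_2^m$ with basis $e_1,\dots,e_m$. An $m$-expansion group is a triple $(G,\phi,(h_1,\dots,h_m))$: $G$ a group, $\phi: G \to V_{[m]}$ a homomorphism with $\phi(h_j) = e_j$, $h_j^2 = 1$, $\ker \phi$ an elementary abelian $2$-group, and $[G,G] = \ker\phi$. For $i \in [n]$ let $B_i = \{k_1+\dots+k_{i-1}+1,\dots,k_1+\dots+k_i\}$ (the $i$-th block), and let $\pi: V_{[m]} \to \mathbb{F}_2^n$ be the linear map sending $e_j$ to the $i$-th standard basis vector whenever $j \in B_i$. A $[(k_1,\dots,k_n)]$-expansion group is an $m$-expansion group such that $\phi^{-1}(\ker \pi)$ is an elementary abelian $2$-group. A homomorphism of such objects is a group homomorphism sending the $j$-th distinguished generator to the $j$-th distinguished generator. Definition of $\widetilde{\mathcal{G}}$: for $x \in [m]$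 let $b(x)$ be such that $x \in B_{b(x)}$. For $i \in [n]$ let $W_i = \mathbb{F}_2^{[n]\setminus\{i\}}$ with basis $(e_h)_{h \neq i}$, and $\Gamma_i = \mathbb{F}_2[W_i] \rtimes W_i$, $W_i$ acting on the group algebra by multiplication by group elements; $[w]$ is the basis element of $w$, and $\varepsilon: \mathbb{F}_2[W_i] \to \mathbb{F}_2$ the augmentation. For $j \in [m]$ let $g_j \in \prod_{x\in[m]}\Gamma_{b(x)}$ have $x$-component $(0,e_h)$ if $j \in B_h$ with $h \neq b(x)$, and $(\delta_{j,x}[0], 0)$ if $j \in B_{b(x)}$. $\widetilde{\mathcal{G}}([(k_1,\dots,k_n)])$ is the subgroup generated by $g_1,\dots,g_m$, and $\widetilde{\phi}$ sends an element whose $x$-component is $(a_x, w_x)$ to $\sum_{x \in [m]} \varepsilon(a_x) e_x$ (so $\widetilde{\phi}(g_j) = e_j$). *)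

theory Defs
  imports "HOL-Algebra.Algebra"
begin

text \<open>Elements of F_2^S are encoded as subsets of S; addition is symmetric difference.\<close>

definition symd :: "'a set \<Rightarrow> 'a set \<Rightarrow> 'a set" where
  "symd A B = (A - B) \<union> (B - A)"

text \<open>V_[m] = F_2^m, basis vector e_j = {j}, coordinates indexed by {1..m}.\<close>
definition Vgrp :: "nat \<Rightarrow> nat set monoid" where
  "Vgrp m = \<lparr>carrier = Pow {1..m}, monoid.mult = symd,monoid.one = {}\<rparr>"

definition elem_ab2 :: "('g, 'c) monoid_scheme \<Rightarrow> 'g set \<Rightarrow> bool" where
  "elem_ab2 G H \<longleftrightarrow> subgroup H G \<and> (\<forall>x\<in>H. \<forall>y\<in>H. x \<otimes>\<^bsub>G\<^esub> y = y \<otimes>\<^bsub>G\<^esub> x)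
     \<and> (\<forall>x\<in>H. x \<otimes>\<^bsub>G\<^esub> x = \<one>\<^bsub>G\<^esub>)"

definition expansion_group ::
  "nat \<Rightarrow> ('g, 'c) monoid_scheme \<Rightarrow> ('g \<Rightarrow> nat set) \<Rightarrow> (nat \<Rightarrow> 'g) \<Rightarrow> bool" where
  "expansion_group m G \<phi> h \<longleftrightarrow> group G \<and> \<phi> \<in> hom G (Vgrp m)
     \<and> (\<forall>j\<in>{1..m}. h j \<in> carrier G \<and> \<phi> (h j) = {j} \<and> h j \<otimes>\<^bsub>G\<^esub> h j = \<one>\<^bsub>G\<^esub>)
     \<and> elem_ab2 G (kernel G (Vgrp m) \<phi>)
     \<and> derived G (carrier G) = kernel G (Vgrp m) \<phi>"

definition msum :: "(nat \<Rightarrow> nat) \<Rightarrow> nat \<Rightarrow> nat" where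
  "msum k n = (\<Sum>i=1..n. k i)"

definition block :: "(nat \<Rightarrow> nat) \<Rightarrow> nat \<Rightarrow> nat set" where
  "block k i = {(\<Sum>l=1..<i. k l) + 1 .. (\<Sum>l=1..i. k l)}"

definition blk :: "(nat \<Rightarrow> nat) \<Rightarrow> nat \<Rightarrow> nat \<Rightarrow> nat" where
  "blk k n x = (THE i. i \<in> {1..n} \<and> x \<in> block k i)"

definition ker_pi :: "(nat \<Rightarrow> nat) \<Rightarrow> nat \<Rightarrow> nat set set" where
  "ker_pi k n = {A. A \<subseteq> {1..msum k n} \<and> (\<forall>i\<in>{1..n}. even (card (A \<inter> block k i)))}"

definition block_expansion_group ::
  "(nat \<Rightarrow> nat) \<Rightarrow> nat \<Rightarrow> ('g, 'c) monoid_scheme \<Rightarrow> ('g \<Rightarrow> nat set) \<Rightarrow> (nat \<Rightarrow> 'g) \<Rightarrow> bool" where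
  "block_expansion_group k n G \<phi> h \<longleftrightarrow> expansion_group (msum k n) G \<phi> h
     \<and> elem_ab2 G {x \<in> carrier G. \<phi> x \<in> ker_pi k n}"

definition expansion_hom ::
  "nat \<Rightarrow> ('g, 'c) monoid_scheme \<Rightarrow> (nat \<Rightarrow> 'g) \<Rightarrow> ('h, 'd) monoid_scheme \<Rightarrow> (nat \<Rightarrow> 'h)
     \<Rightarrow> ('g \<Rightarrow> 'h) \<Rightarrow> bool" where
  "expansion_hom m G g H h f \<longleftrightarrow> f \<in> hom G H \<and> (\<forall>j\<in>{1..m}. f (g j) = h j)"

text \<open>Gamma_i = F_2[W_i] \<rtimes> W_i, W_i = F_2^([n]-{i}) encoded as subsets of {1..n}-{i};
  an element of the group algebra F_2[W_i] is the set of group elements with coefficient 1.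
  The action of w is multiplication by [w], i.e. translation by w.
  Multiplication: (a,w)(a',w') = (a + w.a', w + w').\<close>
definition translate :: "nat set \<Rightarrow> nat set set \<Rightarrow> nat set set" where
  "translate w a = (\<lambda>u. symd u w) ` a"

definition Gamma :: "nat \<Rightarrow> nat \<Rightarrow> (nat set set \<times> nat set) monoid" where
  "Gamma n i = \<lparr>carrier = Pow (Pow ({1..n} - {i})) \<times> Pow ({1..n} - {i}),
     monoid.mult = (\<lambda>(a, w) (a', w'). (symd a (translate w a'), symd w w')),
    monoid.one = ({}, {})\<rparr>"

text \<open>augmentation epsilon: F_2[W] -> F_2 (true = 1).\<close>
definition augm :: "nat set set \<Rightarrow> bool" where
  "augm a = odd (card a)"

definition Gprod :: "(nat \<Rightarrow> nat) \<Rightarrow> nat \<Rightarrow> (nat \<Rightarrow> nat set set \<times> nat set) monoid" where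
  "Gprod k n = product_group {1..msum k n} (\<lambda>x. Gamma n (blk k n x))"

text \<open>The generators g_j; [0] is the basis element {{}} of the zero vector.\<close>
definition gt :: "(nat \<Rightarrow> nat) \<Rightarrow> nat \<Rightarrow> nat \<Rightarrow> (nat \<Rightarrow> nat set set \<times> nat set)" where
  "gt k n j = (\<lambda>x\<in>{1..msum k n}.
      if j \<in> block k (blk k n x) then ((if j = x then {{}} else {}), {})
      else ({}, {blk k n j}))"

definition Gt :: "(nat \<Rightarrow> nat) \<Rightarrow> nat \<Rightarrow> (nat \<Rightarrow> nat set set \<times> nat set) monoid" where
  "Gt k n = subgroup_generated (Gprod k n) (gt k n ` {1..msum k n})"

definition phit :: "(nat \<Rightarrow> nat) \<Rightarrow> nat \<Rightarrow> (nat \<Rightarrow> nat set set \<times> nat set) \<Rightarrow> nat set" where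
  "phit k n f = {x \<in> {1..msum k n}. augm (fst (f x))}"

end

theory Submission
  imports Defs
begin

text \<open>A word in the generators is a walk from 0 in the Cayley graph of \<open>\<pi>(V) = F\<^sub>2\<^sup>n\<close>, with edges
  coloured by 1..m. In the group \<open>Gt\<close> it is recorded by its end point together with the mod 2 chain of
  the edges it traverses, one group algebra \<open>F\<^sub>2[W\<^bsub>b(x)\<^esub>]\<close> for each colour x.
  In a block expansion group G, a choice of elements over the vertices turns every edge into a loop in
  the preimage of \<open>ker \<pi>\<close>. This preimage is an elementary abelian 2-group, so the value of a
  word in G depends only on its chain and its end point; this gives the map from \<open>Gt\<close> to G. It is onto
  since the \<open>h j\<close> generate G, by nilpotency of the augmentation ideal acting on [G,G]. The order
  of \<open>Gt\<close> is \<open>2\<^sup>n\<close> times that of the cycle space of the graph, which has \<open>2\<^sup>n\<close> vertices and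
  \<open>m 2\<^bsup>n-1\<^esup>\<close> edges and is connected.\<close>

subsection \<open>Linear algebra over the field with two elements\<close>

lemma in_symd [simp]: "x \<in> symd A B \<longleftrightarrow> (x \<in> A) \<noteq> (x \<in> B)"
  by (auto simp: symd_def)

lemma symd_commute: "symd A B = symd B A"
  by auto

lemma symd_assoc: "symd (symd A B) C = symd A (symd B C)"
  by auto

lemma symd_left_commute: "symd A (symd B C) = symd B (symd A C)"
  by auto

lemma symd_empty [simp]: "symd A {} = A" "symd {} A = A"
  by auto

lemma symd_self [simp]: "symd A A = {}"
  by auto

lemma symd_cancel [simp]: "symd A (symd A B) = B" "symd (symd B A) A = B"
  by auto

lemma finite_symd [simp]: "finite A \<Longrightarrow> finite B \<Longrightarrow> finite (symd A B)"
  by (auto simp: symd_def)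

lemma symd_subset: "A \<subseteq> C \<Longrightarrow> B \<subseteq> C \<Longrightarrow> symd A B \<subseteq> C"
  by (auto simp: symd_def)

lemma odd_card_symd:
  assumes "finite A" "finite B"
  shows "odd (card (symd A B)) \<longleftrightarrow> odd (card A) \<noteq> odd (card B)"
proof -
  have "card (symd A B) = card (A - B) + card (B - A)"
    unfolding symd_def using assms by (intro card_Un_disjoint) auto
  moreover have "card A = card (A - B) + card (A \<inter> B)"
    using assms by (metis card_Diff_subset_Int card_mono finite_Int inf_le1 le_add_diff_inverse2)
  moreover have "card B = card (B - A) + card (A \<inter> B)"
    using assms by (metis Int_commute card_Diff_subset_Int card_mono finite_Int inf_le1 le_add_diff_inverse2)
  ultimately show ?thesis
    by auto
qed

text \<open>The F_2-linear map sending the basis vector \<open>u\<close> to \<open>F u\<close>: for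
  finite \<open>c\<close> this is the sum of the vectors \<open>F u\<close> over \<open>u\<close> in
  \<open>c\<close>, with the parity of a count as coordinate.\<close>

definition lin :: "('a \<Rightarrow> 'b set) \<Rightarrow> 'a set \<Rightarrow> 'b set" where
  "lin F c = {e. odd (card {u \<in> c. e \<in> F u})}"

lemma lin_empty [simp]: "lin F {} = {}"
  by (simp add: lin_def)

lemma lin_singleton [simp]: "lin F {u} = F u"
proof -
  have "{u' \<in> {u}. e \<in> F u'} = (if e \<in> F u then {u} else {})" for e
    by auto
  then show ?thesis
    by (auto simp: lin_def)
qed

lemma lin_symd:
  assumes "finite A" "finite B"
  shows "lin F (symd A B) = symd (lin F A) (lin F B)"
proof -
  have "{u \<in> symd A B. e \<in> F u} = symd {u \<in> A. e \<in> F u} {u \<in> B. e \<in> F u}" for e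
    by auto
  then show ?thesis
    using assms by (auto simp: lin_def odd_card_symd)
qed

lemma insert_eq_symd: "x \<notin> A \<Longrightarrow> insert x A = symd A {x}"
  by auto

lemma lin_insert: "finite c \<Longrightarrow> u \<notin> c \<Longrightarrow> lin F (insert u c) = symd (lin F c) (F u)"
  by (subst insert_eq_symd, assumption) (simp add: lin_symd)

lemma finite_lin: "finite c \<Longrightarrow> (\<And>u. u \<in> c \<Longrightarrow> finite (F u)) \<Longrightarrow> finite (lin F c)"
  by (induction c rule: finite_induct) (simp_all add: lin_insert)

lemma lin_subset:
  assumes "finite c" "\<And>u. u \<in> c \<Longrightarrow> F u \<subseteq> E"
  shows "lin F c \<subseteq> E"
proof
  fix e assume "e \<in> lin F c"
  then have "card {u \<in> c. e \<in> F u} \<noteq> 0"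
    unfolding lin_def by (intro notI) simp
  then have "{u \<in> c. e \<in> F u} \<noteq> {}"
    by (intro notI) simp
  then show "e \<in> E"
    using assms by auto
qed

lemma lin_lin:
  assumes "finite c" "\<And>u. u \<in> c \<Longrightarrow> finite (P u)"
  shows "lin F (lin P c) = lin (\<lambda>u. lin F (P u)) c"
  using assms
  by (induction c rule: finite_induct) (simp_all add: lin_insert lin_symd finite_lin)

lemma lin_cong: "(\<And>u. u \<in> c \<Longrightarrow> F u = F' u) \<Longrightarrow> lin F c = lin F' c"
  by (simp add: lin_def cong: conj_cong)

text \<open>Toggling \<open>e\<close> multiplies the product by \<open>f e\<close> either way: an
  absent factor is added, a present one cancels because \<open>f e\<close> squares to
  \<open>\<one>\<close>. So products of involutions see their index set modulo 2.\<close>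

lemma (in comm_group) finprod_symd_singleton:
  assumes fin: "finite A" and f: "f \<in> insert e A \<rightarrow> carrier G"
    and sq: "f e \<otimes> f e = \<one>"
  shows "finprod G f (symd A {e}) = finprod G f A \<otimes> f e"
proof (cases "e \<in> A")
  case True
  define A' where "A' = A - {e}"
  have A: "A = insert e A'" "e \<notin> A'" "finite A'" and s: "symd A {e} = A'"
    using True fin by (auto simp: A'_def set_eq_iff)
  have f': "f \<in> A' \<rightarrow> carrier G" "f e \<in> carrier G"
    using f A by auto
  have P: "finprod G f A' \<in> carrier G"
    using f' by simp
  have "finprod G f A = f e \<otimes> finprod G f A'"
    unfolding A(1) using A f' by (intro finprod_insert)
  then have "finprod G f A \<otimes> f e = finprod G f A' \<otimes> (f e \<otimes> f e)"
    using f' P by (simp add: m_ac)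
  then show ?thesis
    using s sq P by simp
next
  case False
  then have "finprod G f (symd A {e}) = f e \<otimes> finprod G f A"
    using fin f by (simp add: insert_eq_symd[symmetric] Pi_def finprod_insert)
  moreover have "finprod G f A \<in> carrier G"
    using f by (intro finprod_closed) auto
  ultimately show ?thesis
    using f by (auto simp: m_comm)
qed

text \<open>Involutive generators are their own inverses, so every element is a word in
  \<open>S\<close>, built by appending letters on the right.\<close>

lemma (in group) generate_involutions_induct [consumes 1, case_names subset square one mult]:
  assumes x: "x \<in> generate G S" and S: "S \<subseteq> carrier G"
    and sq: "\<And>s. s \<in> S \<Longrightarrow> s \<otimes> s = \<one>"
    and one: "P \<one>"
    and mult: "\<And>a s. a \<in> generate G S \<Longrightarrow> s \<in> S \<Longrightarrow> P a \<Longrightarrow> P (a \<otimes> s)"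
  shows "P x"
proof -
  have gc: "generate G S \<subseteq> carrier G"
    using S by (rule generate_incl)
  \<comment> \<open>\<open>generate\<close> multiplies arbitrary elements, not only letters; the
    claim is therefore strengthened to: right multiplication by \<open>x\<close> preserves
    \<open>P\<close>.\<close>
  have "\<forall>a\<in>generate G S. P a \<longrightarrow> P (a \<otimes> x)"
    using x
  proof (induction rule: generate.induct)
    case one
    show ?case using gc by auto
  next
    case (incl s)
    then show ?case using mult by blast
  next
    case (inv s)
    then have "inv s = s"
      using sq S by (metis inv_equality subsetD)
    with inv show ?case using mult by simp
  next
    case (eng h1 h2)
    show ?case
    proof (intro ballI impI)
      fix a assume a: "a \<in> generate G S" "P a"
      have "a \<otimes> h1 \<in> generate G S"
        using a eng by (blast intro: generate.eng)
      moreover have "P (a \<otimes> h1)"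
        using a eng by blast
      ultimately have "P (a \<otimes> h1 \<otimes> h2)"
        using eng by blast
      then show "P (a \<otimes> (h1 \<otimes> h2))"
        using a eng gc by (metis m_assoc subsetD)
    qed
  qed
  moreover have "\<one> \<in> generate G S"
    by (rule generate.one)
  ultimately have "P (\<one> \<otimes> x)"
    using one by blast
  then show ?thesis
    using x gc by auto
qed

lemma Vgrp_simps [simp]:
  "carrier (Vgrp m) = Pow {1..m}" "x \<otimes>\<^bsub>Vgrp m\<^esub> y = symd x y" "\<one>\<^bsub>Vgrp m\<^esub> = {}"
  by (simp_all add: Vgrp_def)

lemma group_Vgrp: "group (Vgrp m)"
proof (rule groupI)
  fix x assume "x \<in> carrier (Vgrp m)"
  then show "\<exists>y\<in>carrier (Vgrp m). y \<otimes>\<^bsub>Vgrp m\<^esub> x = \<one>\<^bsub>Vgrp m\<^esub>"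
    by (intro bexI[of _ x]) auto
qed (auto simp: symd_assoc symd_subset)

subsection \<open>Generators of expansion groups\<close>

lemma (in group) cancel_inv_left:
  assumes "a \<in> carrier G" "b \<in> carrier G"
  shows "inv a \<otimes> (a \<otimes> b) = b" "a \<otimes> (inv a \<otimes> b) = b"
  using assms by (simp_all add: m_assoc[symmetric])

lemma hom_Vgrp_one: "group G \<Longrightarrow> \<phi> \<in> hom G (Vgrp m) \<Longrightarrow> \<phi> \<one>\<^bsub>G\<^esub> = {}"
  using hom_one[of \<phi> G "Vgrp m"] group_Vgrp by simp

lemma hom_Vgrp_inv:
  fixes G (structure)
  assumes "group G" "\<phi> \<in> hom G (Vgrp m)" "x \<in> carrier G"
  shows "\<phi> (inv\<^bsub>G\<^esub> x) = \<phi> x"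
proof -
  interpret group G by fact
  have "symd (\<phi> (inv x)) (\<phi> x) = \<phi> (inv x \<otimes> x)"
    using hom_mult[OF assms(2), of "inv x" x] assms(3) by (simp del: l_inv)
  also have "\<dots> = {}"
    using hom_Vgrp_one[OF assms(1,2)] assms(3) by simp
  finally show ?thesis
    by (metis symd_cancel(1) symd_empty(1))
qed

text \<open>The product of the \<open>h j\<close> over \<open>j\<close> in \<open>A\<close> is a
  preimage. Thus the subgroup generated by the \<open>h j\<close> already maps onto F_2^m.\<close>

lemma exists_preimage_in_generate:
  fixes G (structure)
  assumes "group G" "\<phi> \<in> hom G (Vgrp m)"
    and h: "\<And>j. j \<in> {1..m} \<Longrightarrow> h j \<in> carrier G \<and> \<phi> (h j) = {j}"
    and A: "A \<subseteq> {1..m}"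
  shows "\<exists>u\<in>generate G (h ` {1..m}). \<phi> u = A"
proof -
  interpret group G by fact
  have H: "generate G (h ` {1..m}) \<subseteq> carrier G"
    using h by (intro generate_incl) auto
  have "finite A"
    using A finite_subset by blast
  then show ?thesis
    using A
  proof (induction A rule: finite_induct)
    case empty
    show ?case
      using hom_Vgrp_one[OF assms(1,2)] by (intro bexI[OF _ generate.one])
  next
    case (insert j A)
    then obtain u where u: "u \<in> generate G (h ` {1..m})" "\<phi> u = A"
      by auto
    have j: "h j \<in> generate G (h ` {1..m})" "\<phi> (h j) = {j}"
      using insert.prems h by (auto intro: generate.incl)
    have "\<phi> (u \<otimes> h j) = symd (\<phi> u) (\<phi> (h j))"
      using hom_mult[OF assms(2)] u j H by (metis Vgrp_simps(2) subsetD)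
    then have "\<phi> (u \<otimes> h j) = insert j A"
      using insert_eq_symd[OF insert.hyps(2)] u j by simp
    then show ?case
      using generate.eng[OF u(1) j(1)] by blast
  qed
qed

text \<open>Let N be the kernel of \<open>\<phi>\<close>, H the subgroup generated by the \<open>h j\<close> and M the intersection of
  both. Written additively, N = [G,G] is the sum of M and of all \<open>(h j - 1) N\<close>. As the
  operators \<open>h j - 1\<close> commute and square to zero on N, the summands \<open>(h j - 1) N\<close> can be dropped
  one after the other.\<close>

lemma expansion_group_generated:
  fixes G (structure)
  assumes "expansion_group m G \<phi> h"
  shows "generate G (h ` {1..m}) = carrier G"
proof -
  define N where "N = kernel G (Vgrp m) \<phi>"
  define H where "H = generate G (h ` {1..m})"
  define M where "M = H \<inter> N"
  have grp: "group G" and hom: "\<phi> \<in> hom G (Vgrp m)" and N: "elem_ab2 G N"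
    and der: "derived G (carrier G) = N"
    using assms by (auto simp: expansion_group_def N_def)
  have h: "h j \<in> carrier G" "\<phi> (h j) = {j}" "h j \<otimes>\<^bsub>G\<^esub> h j = \<one>\<^bsub>G\<^esub>" if "j \<in> {1..m}" for j
    using assms that by (auto simp: expansion_group_def)
  interpret group G by fact
  have subN: "subgroup N G"
    using N by (simp add: elem_ab2_def)
  have subH: "subgroup H G"
    unfolding H_def using h by (intro generate_is_subgroup) auto
  have subM: "subgroup M G"
    unfolding M_def by (intro subgroups_Inter_pair subH subN)
  have Nc: "x \<in> carrier G" if "x \<in> N" for x
    using subgroup.mem_carrier[OF subN that] .
  have Hc: "x \<in> carrier G" if "x \<in> H" for x
    using subgroup.mem_carrier[OF subH that] .
  have Ncom: "x \<otimes> y = y \<otimes> x" if "x \<in> N" "y \<in> N" for x y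
    using N that by (simp add: elem_ab2_def)
  have Nsq: "x \<otimes> x = \<one>" if "x \<in> N" for x
    using N that by (simp add: elem_ab2_def)
  have Ninv: "inv x = x" if "x \<in> N" for x
    using Nsq[OF that] Nc[OF that] by (metis inv_equality)
  have Nmul: "x \<otimes> y \<in> N" if "x \<in> N" "y \<in> N" for x y
    using subgroup.m_closed[OF subN that] .
  have Nlcom: "x \<otimes> (y \<otimes> z) = y \<otimes> (x \<otimes> z)" if "x \<in> N" "y \<in> N" "z \<in> N" for x y z
    using that Nc Ncom[of x y] by (simp add: m_assoc[symmetric])
  have \<phi>m: "\<phi> (x \<otimes> y) = symd (\<phi> x) (\<phi> y)" if "x \<in> carrier G" "y \<in> carrier G" for x y
    using hom_mult[OF hom that] by simp
  have inN: "x \<in> N \<longleftrightarrow> x \<in> carrier G \<and> \<phi> x = {}" for x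
    by (auto simp: N_def kernel_def)
  have \<phi>i: "\<phi> (inv x) = \<phi> x" if "x \<in> carrier G" for x
    using hom_Vgrp_inv[OF grp hom that] .
  have conjN: "a \<otimes> y \<otimes> inv a \<in> N" if "a \<in> carrier G" "y \<in> N" for a y
    using that by (simp add: inN \<phi>m \<phi>i)
  have hinv: "inv (h j) = h j" if "j \<in> {1..m}" for j
    using h[OF that] by (metis inv_equality)
  have hh: "h j \<otimes> (h j \<otimes> x) = x" if "j \<in> {1..m}" "x \<in> carrier G" for j x
    using h[OF that(1)] that(2) by (simp add: m_assoc[symmetric])
  \<comment> \<open>\<open>c j\<close> is conjugation by the involution \<open>h j\<close>. Elements
    of N are their own inverses, so \<open>d j\<close> is the operator \<open>h j - 1\<close> in
    additive notation.\<close>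
  define c where "c j y = h j \<otimes> y \<otimes> h j" for j y
  define d where "d j y = c j y \<otimes> y" for j y
  have cN: "c j y \<in> N" if "j \<in> {1..m}" "y \<in> N" for j y
    using conjN[OF h(1)[OF that(1)] that(2)] hinv[OF that(1)] by (simp add: c_def)
  have dN: "d j y \<in> N" if "j \<in> {1..m}" "y \<in> N" for j y
    using cN[OF that] that by (simp add: d_def Nmul)
  have cm: "c j (y \<otimes> z) = c j y \<otimes> c j z" if "j \<in> {1..m}" "y \<in> N" "z \<in> N" for j y z
    using that h(1)[OF that(1)] hh[OF that(1)] Nc by (simp add: c_def m_assoc)
  have cc: "c j (c j y) = y" if "j \<in> {1..m}" "y \<in> N" for j y
    using that h[OF that(1)] hh[OF that(1)] Nc by (simp add: c_def m_assoc)
  have cij: "c i (c j y) = c j (c i y)" if "i \<in> {1..m}" "j \<in> {1..m}" "y \<in> N" for i j y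
  proof -
    let ?p = "h i \<otimes> h j" and ?q = "h j \<otimes> h i"
    have car: "h i \<in> carrier G" "h j \<in> carrier G" "y \<in> carrier G"
      using that h Nc by auto
    \<comment> \<open>The inverse of \<open>?p\<close> is \<open>?q\<close>, so the two composite
      conjugations differ by the one by \<open>?p \<otimes> ?p\<close>. That element lies in the
      commutative group N and hence fixes \<open>y\<close>.\<close>
    have "?p \<otimes> ?p \<in> N"
      using car by (simp add: inN \<phi>m)
    then have *: "?p \<otimes> ?p \<otimes> y = y \<otimes> (?p \<otimes> ?p)"
      using Ncom that by blast
    have "c i (c j y) = ?q \<otimes> (?p \<otimes> ?p \<otimes> y) \<otimes> ?q"
      using car hh that h by (simp add: c_def m_assoc)
    also have "\<dots> = c j (c i y)"
      unfolding * using car hh that h by (simp add: c_def m_assoc)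
    finally show ?thesis .
  qed
  have dm: "d j (y \<otimes> z) = d j y \<otimes> d j z" if "j \<in> {1..m}" "y \<in> N" "z \<in> N" for j y z
    using that cN[OF that(1)] by (simp add: d_def cm m_assoc Nc Nlcom Nmul)
  \<comment> \<open>In characteristic 2, \<open>(h j - 1)^2 = (h j)^2 - 1 = 0\<close>.\<close>
  have dd: "d j (d j y) = \<one>" if "j \<in> {1..m}" "y \<in> N" for j y
    using that cN[OF that(1)] by (simp add: d_def cm cc Ncom[of y "c j y"] Nsq Nmul)
  have dij: "d i (d j y) = d j (d i y)" if "i \<in> {1..m}" "j \<in> {1..m}" "y \<in> N" for i j y
    using that cN[OF that(1)] cN[OF that(2)]
    by (simp add: d_def cm m_assoc Nc Nlcom cij[OF that] Nmul)
  have dH: "d j y \<in> M" if "j \<in> {1..m}" "y \<in> M" for j y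
  proof -
    have "h j \<in> H"
      unfolding H_def using that by (auto intro: generate.incl)
    then have "d j y \<in> H"
      using that subgroup.m_closed[OF subH] by (simp add: d_def c_def M_def)
    then show ?thesis
      using that dN by (simp add: M_def)
  qed
  \<comment> \<open>Generators of the sum of M and the first \<open>t\<close> images
    \<open>(h j - 1) N\<close>; \<open>R 0\<close> is M itself.\<close>
  define R where "R t = M \<union> (\<Union>j\<in>{1..t}. d j ` N)" for t
  have RN: "R t \<subseteq> N" if "t \<le> m" for t
    using that dN by (auto simp: R_def M_def)
  have subS: "subgroup (generate G (R t)) G" if "t \<le> m" for t
    using RN[OF that] Nc by (intro generate_is_subgroup) auto
  have SN: "generate G (R t) \<subseteq> N" if "t \<le> m" for t
    using generate_subgroup_incl[OF RN[OF that] subN] .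
  have split: "\<exists>u\<in>H. \<exists>y\<in>N. a = u \<otimes> y" if a: "a \<in> carrier G" for a
  proof -
    have "\<phi> a \<subseteq> {1..m}"
      using hom_in_carrier[OF hom a] by simp
    then obtain u where u: "u \<in> H" "\<phi> u = \<phi> a"
      using exists_preimage_in_generate[OF grp hom, of h "\<phi> a"] h unfolding H_def by blast
    have "inv u \<otimes> a \<in> N"
      using u a Hc by (simp add: inN \<phi>m \<phi>i)
    moreover have "a = u \<otimes> (inv u \<otimes> a)"
      using u a Hc by (simp add: cancel_inv_left)
    ultimately show ?thesis
      using u by blast
  qed
  have top: "N \<subseteq> generate G (R m)"
  proof -
    let ?Y = "generate G (R m)"
    have Ym: "x \<otimes> y \<in> ?Y" if "x \<in> ?Y" "y \<in> ?Y" for x y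
      using that by (rule generate.eng)
    have YN: "x \<in> N" if "x \<in> ?Y" for x
      using SN[of m] that by auto
    have Yd: "d j y \<in> ?Y" if "j \<in> {1..m}" "y \<in> N" for j y
      using that by (intro generate.incl) (auto simp: R_def)
    have YM: "y \<in> ?Y" if "y \<in> M" for y
      using that by (intro generate.incl) (auto simp: R_def)
    \<comment> \<open>Induction on the word \<open>u\<close>, using
      \<open>u s - 1 = (u - 1) s + (s - 1)\<close>.\<close>
    have actH: "\<forall>y\<in>N. u \<otimes> y \<otimes> inv u \<otimes> y \<in> ?Y" if "u \<in> H" for u
      using that unfolding H_def
    proof (induction rule: generate_involutions_induct)
      case one
      show ?case using Nc Nsq by (auto intro: generate.one)
    next
      case (mult u s)
      then obtain j where j: "j \<in> {1..m}" "s = h j" by auto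
      have uc: "u \<in> carrier G" using mult Hc by (simp add: H_def)
      show ?case
      proof
        fix y assume y: "y \<in> N"
        let ?z = "c j y"
        have z: "?z \<in> N" using cN j y by blast
        have "u \<otimes> s \<otimes> y \<otimes> inv (u \<otimes> s) \<otimes> y = u \<otimes> ?z \<otimes> inv u \<otimes> y"
          using j uc y Nc h hinv by (simp add: c_def m_assoc inv_mult_group)
        also have "\<dots> = (u \<otimes> ?z \<otimes> inv u \<otimes> ?z) \<otimes> d j y"
          using uc y z Nc Nsq by (simp add: d_def m_assoc[symmetric]) (simp add: m_assoc)
        finally show "u \<otimes> s \<otimes> y \<otimes> inv (u \<otimes> s) \<otimes> y \<in> ?Y"
          using mult z Yd[OF j(1) y] Ym by simp
      qed
    qed (use h in auto)
    have act: "a \<otimes> y \<otimes> inv a \<otimes> y \<in> ?Y" if a: "a \<in> carrier G" and y: "y \<in> N" for a y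
    proof -
      obtain u x where u: "u \<in> H" "x \<in> N" "a = u \<otimes> x"
        using split[OF a] by blast
      \<comment> \<open>N is commutative, so the factor \<open>x\<close> acts trivially on it and
        only \<open>u\<close> matters.\<close>
      have "a \<otimes> y \<otimes> inv a = u \<otimes> (x \<otimes> y \<otimes> x) \<otimes> inv u"
        using u y Hc Nc Ninv by (simp add: m_assoc inv_mult_group)
      also have "x \<otimes> y \<otimes> x = y"
        using u y Nc Nsq by (simp add: Ncom[of x y] m_assoc)
      finally show ?thesis
        using actH u y by simp
    qed
    have nrm: "a \<otimes> y \<otimes> inv a \<in> ?Y" if a: "a \<in> carrier G" and y: "y \<in> ?Y" for a y
    proof -
      have "a \<otimes> y \<otimes> inv a = (a \<otimes> y \<otimes> inv a \<otimes> y) \<otimes> y"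
        using a YN[OF y] Nc Nsq by (simp add: m_assoc)
      then show ?thesis
        using Ym[OF act[OF a YN[OF y]] y] by simp
    qed
    have "a \<otimes> b \<otimes> inv a \<otimes> inv b \<in> ?Y" if a: "a \<in> carrier G" and b: "b \<in> carrier G" for a b
    proof -
      obtain u y where u: "u \<in> H" "y \<in> N" "a = u \<otimes> y"
        using split[OF a] by blast
      obtain v z where v: "v \<in> H" "z \<in> N" "b = v \<otimes> z"
        using split[OF b] by blast
      note car = Hc[OF u(1)] Hc[OF v(1)] Nc[OF u(2)] Nc[OF v(2)]
      have "u \<otimes> v \<otimes> inv u \<otimes> inv v \<in> M"
        using u v car subgroup.m_closed[OF subH] subgroup.m_inv_closed[OF subH]
        by (auto simp: M_def inN \<phi>m \<phi>i)
      then have 1: "u \<otimes> v \<otimes> inv u \<otimes> inv v \<in> ?Y"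
        by (rule YM)
      have 2: "v \<otimes> (u \<otimes> z \<otimes> inv u \<otimes> z) \<otimes> inv v \<in> ?Y"
        using act nrm car u v by blast
      have "b \<otimes> y \<otimes> inv b \<otimes> y \<in> ?Y"
        using act b u by blast
      moreover have "b \<otimes> y \<otimes> inv b \<otimes> y = y \<otimes> (b \<otimes> y \<otimes> inv b)"
        using conjN b u Ncom by blast
      ultimately have 3: "u \<otimes> (y \<otimes> (b \<otimes> y \<otimes> inv b)) \<otimes> inv u \<in> ?Y"
        using nrm[OF car(1)] by simp
      \<comment> \<open>Expanding both arguments leaves the commutator of \<open>u\<close> and
        \<open>v\<close>, which lies in M, and conjugates of \<open>(b - 1) y\<close> and
        \<open>(u - 1) z\<close>.\<close>
      have "a \<otimes> b \<otimes> inv a \<otimes> inv b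
          = (u \<otimes> (y \<otimes> (b \<otimes> y \<otimes> inv b)) \<otimes> inv u) \<otimes> (u \<otimes> b \<otimes> inv u \<otimes> inv b)"
        using b car Ninv[OF u(2)] unfolding u(3)
        by (simp add: m_assoc inv_mult_group cancel_inv_left)
      also have "u \<otimes> b \<otimes> inv u \<otimes> inv b
          = (u \<otimes> v \<otimes> inv u \<otimes> inv v) \<otimes> (v \<otimes> (u \<otimes> z \<otimes> inv u \<otimes> z) \<otimes> inv v)"
        using car Ninv[OF v(2)] unfolding v(3)
        by (simp add: m_assoc inv_mult_group cancel_inv_left)
      finally show ?thesis
        using 1 2 3 Ym by simp
    qed
    then have "derived G (carrier G) \<subseteq> ?Y"
      unfolding derived_def by (intro generate_subgroup_incl subS) auto
    then show ?thesis
      using der by simp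
  qed
  have "N \<subseteq> generate G (R (m - t))" if "t \<le> m" for t
    using that
  proof (induction t)
    case 0
    show ?case using top by simp
  next
    case (Suc t)
    let ?s = "m - Suc t"
    have s: "?s \<le> m" "m - t = Suc ?s" and sm: "Suc ?s \<in> {1..m}"
      using Suc.prems by auto
    have IH: "N \<subseteq> generate G (R (Suc ?s))"
      using Suc s by simp
    \<comment> \<open>\<open>d (Suc ?s)\<close> maps the generators of the larger sum into the
      smaller one: M is stable, its own image is killed by \<open>dd\<close>, which gives
      \<open>\<one>\<close>, and the other images are stable by \<open>dij\<close>.\<close>
    have base: "d (Suc ?s) y \<in> insert \<one> (R ?s)" if y: "y \<in> R (Suc ?s)" for y
    proof -
      consider "y \<in> M" | z where "z \<in> N" "y = d (Suc ?s) z"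
        | j z where "j \<in> {1..?s}" "z \<in> N" "y = d j z"
        using y by (auto simp: R_def le_Suc_eq)
      then show ?thesis
      proof cases
        case 1
        then show ?thesis using dH[OF sm] by (simp add: R_def)
      next
        case 2
        then show ?thesis using dd[OF sm] by simp
      next
        case 3
        then have "j \<in> {1..m}" using s(1) by auto
        then have "d (Suc ?s) y = d j (d (Suc ?s) z)"
          using 3 dij[OF sm] by simp
        moreover have "d (Suc ?s) z \<in> N"
          using dN[OF sm] 3 by simp
        ultimately show ?thesis
          using 3(1) unfolding R_def by blast
      qed
    qed
    have step: "d (Suc ?s) y \<in> generate G (R ?s)" if "y \<in> generate G (R (Suc ?s))" for y
      using that
    proof (induction rule: generate.induct)
      case one
      have "\<one> \<in> M" using subM by (rule subgroup.one_closed)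
      then show ?case using dH[OF sm] by (intro generate.incl) (auto simp: R_def)
    next
      case (incl y)
      then have "d (Suc ?s) y \<in> insert \<one> (R ?s)"
        by (rule base)
      then show ?case by (auto intro: generate.one generate.incl)
    next
      case (inv y)
      then have "inv y = y" using RN[of "Suc ?s"] sm Ninv by auto
      moreover have "d (Suc ?s) y \<in> insert \<one> (R ?s)"
        using inv by (rule base)
      ultimately show ?case by (auto intro: generate.one generate.incl)
    next
      case (eng y z)
      then have "y \<in> N" "z \<in> N" using SN[of "Suc ?s"] sm by auto
      then show ?case using dm[OF sm] eng by (auto intro: generate.eng)
    qed
    have Rs: "{1..Suc ?s} = insert (Suc ?s) {1..?s}"
      by auto
    have "R (Suc ?s) \<subseteq> generate G (R ?s)"
    proof
      fix x assume "x \<in> R (Suc ?s)"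
      then consider "x \<in> R ?s" | y where "y \<in> N" "x = d (Suc ?s) y"
        unfolding R_def Rs by blast
      then show "x \<in> generate G (R ?s)"
        using step IH by cases (auto intro: generate.incl)
    qed
    then show ?case
      using generate_subgroup_incl[OF _ subS[OF s(1)]] IH by blast
  qed
  from this[of m] have "N \<subseteq> generate G (R 0)" by simp
  also have "\<dots> \<subseteq> M"
    using generate_subgroup_incl[OF _ subM, of "R 0"] by (simp add: R_def)
  finally have "N \<subseteq> H" by (auto simp: M_def)
  then have "carrier G \<subseteq> H"
    using split subgroup.m_closed[OF subH] by blast
  then show ?thesis
    using subgroup.subset[OF subH] by (auto simp: H_def)
qed

text \<open>In the abelianization, the class of a word in the involutions \<open>h j\<close> depends
  only on which letters occur an odd number of times, that is, on its value under
  \<open>\<phi>\<close>. If this value is zero, the class is trivial.\<close>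

lemma kernel_subset_derived:
  fixes G (structure)
  assumes "group G" "\<phi> \<in> hom G (Vgrp m)"
    and h: "\<And>j. j \<in> {1..m} \<Longrightarrow> h j \<in> carrier G \<and> \<phi> (h j) = {j} \<and> h j \<otimes>\<^bsub>G\<^esub> h j = \<one>\<^bsub>G\<^esub>"
    and gen: "generate G (h ` {1..m}) = carrier G"
  shows "kernel G (Vgrp m) \<phi> \<subseteq> derived G (carrier G)"
proof -
  interpret group G by fact
  let ?D = "derived G (carrier G)"
  interpret D: normal ?D G
    by (rule derived_self_is_normal)
  interpret Q: comm_group "G Mod ?D"
    by (rule derived_quot_is_comm_group)
  let ?f = "\<lambda>j. ?D #> h j"
  have Qm: "(?D #> a) \<otimes>\<^bsub>G Mod ?D\<^esub> (?D #> b) = ?D #> (a \<otimes> b)"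
    if "a \<in> carrier G" "b \<in> carrier G" for a b
    using that by (simp add: FactGroup_def D.rcos_sum)
  have Q1: "\<one>\<^bsub>G Mod ?D\<^esub> = ?D" "?D #> \<one> = ?D"
    using D.subset by (auto simp: FactGroup_def coset_mult_one)
  have fc: "?f j \<in> carrier (G Mod ?D)" if "j \<in> {1..m}" for j
    using h[OF that] by (auto simp: FactGroup_def RCOSETS_def)
  have key: "?D #> a = finprod (G Mod ?D) ?f (\<phi> a)" if "a \<in> generate G (h ` {1..m})" for a
    using that
  proof (induction rule: generate_involutions_induct)
    case one
    then show ?case using Q1 hom_Vgrp_one[OF assms(1,2)] by simp
  next
    case (mult a s)
    then obtain j where j: "j \<in> {1..m}" "s = h j" by auto
    have a: "a \<in> carrier G" using mult gen by simp
    have sub: "\<phi> a \<subseteq> {1..m}"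
      using hom_in_carrier[OF assms(2) a] by simp
    have "?f j \<otimes>\<^bsub>G Mod ?D\<^esub> ?f j = ?D #> (h j \<otimes> h j)"
      using h[OF j(1)] by (intro Qm) auto
    then have sq: "?f j \<otimes>\<^bsub>G Mod ?D\<^esub> ?f j = \<one>\<^bsub>G Mod ?D\<^esub>"
      using h[OF j(1)] Q1 by simp
    have "finprod (G Mod ?D) ?f (symd (\<phi> a) {j}) = finprod (G Mod ?D) ?f (\<phi> a) \<otimes>\<^bsub>G Mod ?D\<^esub> ?f j"
      using sub fc j finite_subset[OF sub]
      by (intro Q.finprod_symd_singleton sq) auto
    moreover have "\<phi> (a \<otimes> s) = symd (\<phi> a) {j}"
      using hom_mult[OF assms(2) a] h[OF j(1)] j by simp
    ultimately show ?case
      using mult Qm[of a "h j"] a h[OF j(1)] j by simp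
  qed (use h in auto)
  show ?thesis
  proof
    fix a assume "a \<in> kernel G (Vgrp m) \<phi>"
    then have a: "a \<in> carrier G" "\<phi> a = {}"
      by (auto simp: kernel_def)
    then have "?D #> a = ?D"
      using key[of a] gen Q1 by simp
    then show "a \<in> ?D"
      using rcos_self[OF a(1) D.subgroup_axioms] by simp
  qed
qed

lemma derived_subset_kernel:
  fixes G (structure)
  assumes "group G" "\<phi> \<in> hom G (Vgrp m)"
  shows "derived G (carrier G) \<subseteq> kernel G (Vgrp m) \<phi>"
proof -
  interpret group_hom G "Vgrp m" \<phi>
    using assms group_Vgrp by (simp add: group_hom_def group_hom_axioms_def)
  show ?thesis
    unfolding derived_def
  proof (rule G.generate_subgroup_incl[OF _ subgroup_kernel])
    show "derived_set G (carrier G) \<subseteq> kernel G (Vgrp m) \<phi>"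
      using hom_Vgrp_inv[OF assms] G.subgroup_self
      by (auto simp: kernel_def)
  qed
qed

subsection \<open>The universal group as a group of walks\<close>

lemma block_unique:
  assumes "x \<in> block k i" "x \<in> block k j"
  shows "i = j"
proof -
  have *: False if "i < j" "x \<in> block k i" "x \<in> block k j" for i j
  proof -
    have "(\<Sum>l=1..i. k l) \<le> (\<Sum>l=1..<j. k l)"
      using that(1) by (intro sum_mono2) auto
    then show False
      using that(2,3) by (auto simp: block_def)
  qed
  show ?thesis
    using *[of i j] *[of j i] assms by (meson linorder_neqE_nat)
qed

lemma sum_Icc_eq_Ico: "1 \<le> i \<Longrightarrow> (\<Sum>l=1..i. k l) = (\<Sum>l=1..<i. k l) + k i" for i :: nat
  by (metis atLeastLessThanSuc_atLeastAtMost le_eq_less_or_eq sum.atLeastLessThan_Suc)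

lemma block_nonempty: "1 \<le> i \<Longrightarrow> 1 \<le> k i \<Longrightarrow> (\<Sum>l=1..<i. k l) + 1 \<in> block k i"
  using sum_Icc_eq_Ico[of i k] by (simp add: block_def)

lemma block_subset: "i \<in> {1..n} \<Longrightarrow> block k i \<subseteq> {1..msum k n}"
proof -
  assume "i \<in> {1..n}"
  then have "(\<Sum>l=1..i. k l) \<le> msum k n"
    unfolding msum_def by (intro sum_mono2) auto
  then show ?thesis
    by (auto simp: block_def)
qed

lemma ex_block: "x \<in> {1..msum k n} \<Longrightarrow> \<exists>i\<in>{1..n}. x \<in> block k i"
proof (induction n)
  case 0
  then show ?case by (simp add: msum_def)
next
  case (Suc n)
  show ?case
  proof (cases "x \<le> msum k n")
    case True
    then obtain i where "i \<in> {1..n}" "x \<in> block k i"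
      using Suc by auto
    then show ?thesis by auto
  next
    case False
    then have "x \<in> block k (Suc n)"
      using Suc.prems by (simp add: block_def msum_def atLeastLessThanSuc_atLeastAtMost)
    then show ?thesis by auto
  qed
qed

lemma blk_in: "x \<in> {1..msum k n} \<Longrightarrow> blk k n x \<in> {1..n}"
  and blk_block: "x \<in> {1..msum k n} \<Longrightarrow> x \<in> block k (blk k n x)"
proof -
  assume "x \<in> {1..msum k n}"
  then have "\<exists>!i. i \<in> {1..n} \<and> x \<in> block k i"
    using ex_block block_unique by metis
  from theI'[OF this] show "blk k n x \<in> {1..n}" "x \<in> block k (blk k n x)"
    by (auto simp: blk_def)
qed

lemma blk_iff: "x \<in> {1..msum k n} \<Longrightarrow> x \<in> block k i \<longleftrightarrow> i = blk k n x"
  using blk_block block_unique by metis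

text \<open>This is \<open>\<pi>\<close> in the encoding of vectors as sets.\<close>

definition bpar :: "(nat \<Rightarrow> nat) \<Rightarrow> nat \<Rightarrow> nat set \<Rightarrow> nat set" where
  "bpar k n A = {i \<in> {1..n}. odd (card (A \<inter> block k i))}"

lemma bpar_subset: "bpar k n A \<subseteq> {1..n}"
  by (auto simp: bpar_def)

lemma bpar_empty [simp]: "bpar k n {} = {}"
  by (simp add: bpar_def)

lemma bpar_symd:
  assumes "A \<subseteq> {1..msum k n}" "B \<subseteq> {1..msum k n}"
  shows "bpar k n (symd A B) = symd (bpar k n A) (bpar k n B)"
proof -
  have "symd A B \<inter> block k i = symd (A \<inter> block k i) (B \<inter> block k i)" for i
    by auto
  moreover have "finite A" "finite B"
    using assms finite_subset by auto
  ultimately show ?thesis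
    by (auto simp: bpar_def odd_card_symd)
qed

lemma bpar_singleton:
  assumes "j \<in> {1..msum k n}"
  shows "bpar k n {j} = {blk k n j}"
proof -
  have "{j} \<inter> block k i = (if i = blk k n j then {j} else {})" for i
    using blk_iff[OF assms] by auto
  then show ?thesis
    using blk_in[OF assms] by (auto simp: bpar_def)
qed

lemma ker_pi_eq: "ker_pi k n = {A. A \<subseteq> {1..msum k n} \<and> bpar k n A = {}}"
  by (auto simp: ker_pi_def bpar_def)

lemma bpar_hom:
  assumes "\<phi> \<in> hom G (Vgrp (msum k n))"
  shows "(\<lambda>x. bpar k n (\<phi> x)) \<in> hom G (Vgrp n)"
proof (rule homI)
  show "bpar k n (\<phi> x) \<in> carrier (Vgrp n)" for x
    using bpar_subset by simp
  fix x y assume "x \<in> carrier G" "y \<in> carrier G"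
  moreover from this have "\<phi> x \<subseteq> {1..msum k n}" "\<phi> y \<subseteq> {1..msum k n}"
    using hom_in_carrier[OF assms] by auto
  ultimately show "bpar k n (\<phi> (x \<otimes>\<^bsub>G\<^esub> y)) = bpar k n (\<phi> x) \<otimes>\<^bsub>Vgrp n\<^esub> bpar k n (\<phi> y)"
    using hom_mult[OF assms] by (simp add: bpar_symd)
qed

section \<open>Translations of the group algebra and the groups \<open>Gamma n i\<close>\<close>

lemma in_translate: "e \<in> translate w a \<longleftrightarrow> symd e w \<in> a"
proof
  assume "symd e w \<in> a"
  then have "symd (symd e w) w \<in> translate w a"
    unfolding translate_def by blast
  then show "e \<in> translate w a"
    by simp
qed (auto simp: translate_def)

lemma translate_empty [simp]: "translate {} a = a" "translate w {} = {}"
  by (auto simp: in_translate)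

lemma translate_singleton [simp]: "translate w {u} = {symd u w}"
  by (simp add: translate_def)

lemma translate_symd: "translate w (symd a b) = symd (translate w a) (translate w b)"
  by (auto simp: in_translate)

lemma translate_translate: "translate w (translate v a) = translate (symd w v) a"
  by (auto simp: in_translate symd_assoc)

lemma translate_subset: "w \<subseteq> S \<Longrightarrow> a \<subseteq> Pow S \<Longrightarrow> translate w a \<subseteq> Pow S"
  by (auto simp: translate_def symd_def)

lemma card_translate: "card (translate w a) = card a"
  unfolding translate_def by (intro card_image inj_onI) (metis symd_cancel(2))

lemma Gamma_simps:
  "carrier (Gamma n i) = Pow (Pow ({1..n} - {i})) \<times> Pow ({1..n} - {i})"
  "p \<otimes>\<^bsub>Gamma n i\<^esub> q = (symd (fst p) (translate (snd p) (fst q)), symd (snd p) (snd q))"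
  "\<one>\<^bsub>Gamma n i\<^esub> = ({}, {})"
  by (simp_all add: Gamma_def case_prod_beta)

lemma group_Gamma: "group (Gamma n i)"
proof (rule groupI)
  fix p assume p: "p \<in> carrier (Gamma n i)"
  \<comment> \<open>The usual inverse in a semidirect product; all signs vanish because F_2[W] and W
    have exponent 2.\<close>
  let ?q = "(translate (snd p) (fst p), snd p)"
  have "?q \<in> carrier (Gamma n i)"
    using p translate_subset[of "snd p" "{1..n} - {i}" "fst p"]
    by (simp add: Gamma_simps mem_Times_iff)
  moreover have "?q \<otimes>\<^bsub>Gamma n i\<^esub> p = \<one>\<^bsub>Gamma n i\<^esub>"
    by (simp add: Gamma_simps)
  ultimately show "\<exists>q\<in>carrier (Gamma n i). q \<otimes>\<^bsub>Gamma n i\<^esub> p = \<one>\<^bsub>Gamma n i\<^esub>"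
    by blast
next
  fix p q assume p: "p \<in> carrier (Gamma n i)" "q \<in> carrier (Gamma n i)"
  then have "translate (snd p) (fst q) \<subseteq> Pow ({1..n} - {i})"
    by (intro translate_subset) (auto simp: Gamma_simps)
  with p show "p \<otimes>\<^bsub>Gamma n i\<^esub> q \<in> carrier (Gamma n i)"
    using symd_subset[of "fst p" "Pow ({1..n} - {i})"] symd_subset[of "snd p" "{1..n} - {i}"]
    by (auto simp only: Gamma_simps mem_Times_iff Pow_iff fst_conv snd_conv)
qed (auto simp: Gamma_simps symd_assoc translate_symd translate_translate)

lemma group_Gprod: "group (Gprod k n)"
  unfolding Gprod_def using group_Gamma by simp

section \<open>Walks, their end points and their chains\<close>

locale blocks =
  fixes k :: "nat \<Rightarrow> nat" and n :: nat
begin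

abbreviation m :: nat where "m \<equiv> msum k n"
abbreviation b :: "nat \<Rightarrow> nat" where "b \<equiv> blk k n"
abbreviation g :: "nat \<Rightarrow> nat \<Rightarrow> nat set set \<times> nat set" where "g \<equiv> gt k n"
abbreviation \<Gamma> :: "(nat \<Rightarrow> nat set set \<times> nat set) monoid" where "\<Gamma> \<equiv> Gt k n"

text \<open>The walk in the Cayley graph of \<open>F\<^sub>2\<^sup>n\<close> attached to an element of \<open>\<Gamma>\<close> ends in the vertex
  \<open>endpt a\<close>. The edge of colour x joining w and \<open>w + e\<^sub>i\<close>, i = b x, is the pair (x, w)
  with i not in w, and \<open>chain a\<close> is the set of edges that are traversed an odd number of times.\<close>

definition endpt :: "(nat \<Rightarrow> nat set set \<times> nat set) \<Rightarrow> nat set" where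
  "endpt a = bpar k n (phit k n a)"

definition chain :: "(nat \<Rightarrow> nat set set \<times> nat set) \<Rightarrow> (nat \<times> nat set) set" where
  "chain a = {(x, w). x \<in> {1..m} \<and> w \<in> fst (a x)}"

definition edges :: "(nat \<times> nat set) set" where
  "edges = (SIGMA x:{1..m}. Pow ({1..n} - {b x}))"

lemma g_apply:
  assumes "j \<in> {1..m}" "x \<in> {1..m}"
  shows "g j x = (if b j = b x then (if j = x then {{}} else {}, {}) else ({}, {b j}))"
  using assms blk_iff[OF assms(1)] by (auto simp: gt_def)

lemma Gprod_mult: "x \<in> {1..m} \<Longrightarrow> (a \<otimes>\<^bsub>Gprod k n\<^esub> c) x =
    (symd (fst (a x)) (translate (snd (a x)) (fst (c x))), symd (snd (a x)) (snd (c x)))"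
  by (simp add: Gprod_def Gamma_simps)

lemma carrier_Gprod: "carrier (Gprod k n) =
    (\<Pi>\<^sub>E x\<in>{1..m}. Pow (Pow ({1..n} - {b x})) \<times> Pow ({1..n} - {b x}))"
  by (simp add: Gprod_def Gamma_simps)

lemma g_in_Gprod: "j \<in> {1..m} \<Longrightarrow> g j \<in> carrier (Gprod k n)"
proof -
  assume j: "j \<in> {1..m}"
  have "g j \<in> extensional {1..m}"
    by (simp add: gt_def)
  then show ?thesis
    unfolding carrier_Gprod using g_apply[OF j] blk_in[OF j] by (auto simp: PiE_iff)
qed

lemma carrier_Gt: "carrier \<Gamma> = generate (Gprod k n) (g ` {1..m})"
proof -
  have "carrier (Gprod k n) \<inter> g ` {1..m} = g ` {1..m}"
    using g_in_Gprod by auto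
  then show ?thesis
    by (simp add: Gt_def carrier_subgroup_generated)
qed

lemma Gt_simps: "a \<otimes>\<^bsub>\<Gamma>\<^esub> c = a \<otimes>\<^bsub>Gprod k n\<^esub> c" "\<one>\<^bsub>\<Gamma>\<^esub> = \<one>\<^bsub>Gprod k n\<^esub>"
  by (simp_all add: Gt_def)

lemma group_Gt: "group \<Gamma>"
  unfolding Gt_def by (rule group.group_subgroup_generated[OF group_Gprod])

sublocale \<Gamma>: group \<Gamma>
  by (rule group_Gt)

lemma Gt_subset_Gprod: "carrier \<Gamma> \<subseteq> carrier (Gprod k n)"
  unfolding Gt_def by (rule group.carrier_subgroup_generated_subset[OF group_Gprod])

lemma Gt_mult: "x \<in> {1..m} \<Longrightarrow> (a \<otimes>\<^bsub>\<Gamma>\<^esub> c) x =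
    (symd (fst (a x)) (translate (snd (a x)) (fst (c x))), symd (snd (a x)) (snd (c x)))"
  by (simp add: Gt_simps Gprod_mult)

lemma Gt_one: "x \<in> {1..m} \<Longrightarrow> \<one>\<^bsub>\<Gamma>\<^esub> x = ({}, {})"
  by (simp add: Gt_simps Gprod_def Gamma_simps)

lemma Gt_ext:
  assumes "a \<in> carrier \<Gamma>" "c \<in> carrier \<Gamma>" "\<And>x. x \<in> {1..m} \<Longrightarrow> a x = c x"
  shows "a = c"
  using assms Gt_subset_Gprod unfolding carrier_Gprod by (meson PiE_ext subsetD)

lemma Gt_component:
  assumes "a \<in> carrier \<Gamma>" "x \<in> {1..m}"
  shows "fst (a x) \<subseteq> Pow ({1..n} - {b x})"
  using assms Gt_subset_Gprod unfolding carrier_Gprod by (fastforce simp: PiE_iff mem_Times_iff)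

lemma g_in_Gt: "j \<in> {1..m} \<Longrightarrow> g j \<in> carrier \<Gamma>"
  unfolding carrier_Gt by (auto intro: generate.incl)

lemma g_square: "j \<in> {1..m} \<Longrightarrow> g j \<otimes>\<^bsub>\<Gamma>\<^esub> g j = \<one>\<^bsub>\<Gamma>\<^esub>"
  by (rule Gt_ext) (auto simp: g_in_Gt Gt_mult Gt_one g_apply)

text \<open>Every element is reached from the identity by extending a walk one edge at a
  time.\<close>

lemma Gt_induct [consumes 1, case_names one mult]:
  assumes "a \<in> carrier \<Gamma>" "P \<one>\<^bsub>\<Gamma>\<^esub>"
    and "\<And>a j. a \<in> carrier \<Gamma> \<Longrightarrow> j \<in> {1..m} \<Longrightarrow> P a \<Longrightarrow> P (a \<otimes>\<^bsub>\<Gamma>\<^esub> g j)"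
  shows "P a"
  using assms(1) unfolding carrier_Gt
proof (induction rule: group.generate_involutions_induct[OF group_Gprod,
      consumes 1, case_names subset square one mult])
  case subset
  then show ?case using g_in_Gprod by auto
next
  case (square s)
  then show ?case using g_square by (auto simp: Gt_simps)
next
  case one
  then show ?case using assms(2) by (simp add: Gt_simps)
next
  case (mult a s)
  then show ?case using assms(3) by (auto simp: Gt_simps carrier_Gt)
qed

lemma generate_Gt: "generate \<Gamma> (g ` {1..m}) = carrier \<Gamma>"
proof
  show "generate \<Gamma> (g ` {1..m}) \<subseteq> carrier \<Gamma>"
    using g_in_Gt by (intro \<Gamma>.generate_incl) auto
  show "carrier \<Gamma> \<subseteq> generate \<Gamma> (g ` {1..m})"
  proof
    fix a assume "a \<in> carrier \<Gamma>"
    then show "a \<in> generate \<Gamma> (g ` {1..m})"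
      by (induction rule: Gt_induct) (blast intro: generate.intros)+
  qed
qed

text \<open>Translation permutes the basis of the group algebra and so keeps the augmentation, which
  is therefore additive despite the twisted multiplication.\<close>

lemma phit_hom: "phit k n \<in> hom \<Gamma> (Vgrp m)"
proof (rule homI)
  show "phit k n a \<in> carrier (Vgrp m)" for a
    by (auto simp: phit_def)
  fix a c assume ac: "a \<in> carrier \<Gamma>" "c \<in> carrier \<Gamma>"
  have "augm (fst ((a \<otimes>\<^bsub>\<Gamma>\<^esub> c) x)) \<longleftrightarrow> augm (fst (a x)) \<noteq> augm (fst (c x))"
    if x: "x \<in> {1..m}" for x
  proof -
    have "finite (fst (a x))" "finite (fst (c x))"
      using ac[THEN Gt_component, OF x] by (auto intro: finite_subset)
    then show ?thesis
      using x by (simp add: Gt_mult augm_def odd_card_symd card_translate translate_def)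
        (simp add: translate_def[symmetric] card_translate)
  qed
  then show "phit k n (a \<otimes>\<^bsub>\<Gamma>\<^esub> c) = phit k n a \<otimes>\<^bsub>Vgrp m\<^esub> phit k n c"
    by (auto simp: phit_def)
qed

lemma phit_g: "j \<in> {1..m} \<Longrightarrow> phit k n (g j) = {j}"
  by (auto simp: phit_def g_apply augm_def split: if_splits)

lemma endpt_hom: "endpt \<in> hom \<Gamma> (Vgrp n)"
  using bpar_hom[OF phit_hom] unfolding endpt_def .

lemma endpt_mult:
  "a \<in> carrier \<Gamma> \<Longrightarrow> c \<in> carrier \<Gamma> \<Longrightarrow> endpt (a \<otimes>\<^bsub>\<Gamma>\<^esub> c) = symd (endpt a) (endpt c)"
  using hom_mult[OF endpt_hom] by simp

lemma endpt_g: "j \<in> {1..m} \<Longrightarrow> endpt (g j) = {b j}"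
  by (simp add: endpt_def phit_g bpar_singleton)

lemma endpt_one: "endpt \<one>\<^bsub>\<Gamma>\<^esub> = {}"
  using hom_Vgrp_one[OF group_Gt endpt_hom] .

lemma endpt_subset: "endpt a \<subseteq> {1..n}"
  unfolding endpt_def by (rule bpar_subset)

text \<open>Component \<open>x\<close> sees the current vertex modulo the direction
  \<open>b x\<close>: \<open>g j\<close> moves it unless \<open>j\<close> and \<open>x\<close> share
  a block. The end point thus recovers all second components.\<close>

lemma snd_Gt: "a \<in> carrier \<Gamma> \<Longrightarrow> x \<in> {1..m} \<Longrightarrow> snd (a x) = endpt a - {b x}"
proof (induction rule: Gt_induct)
  case one
  then show ?case by (simp add: Gt_one endpt_one)
next
  case (mult a j)
  then have "snd ((a \<otimes>\<^bsub>\<Gamma>\<^esub> g j) x) = symd (endpt a - {b x}) (if b j = b x then {} else {b j})"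
    by (simp add: Gt_mult g_apply)
  also have "\<dots> = symd (endpt a) {b j} - {b x}"
    by (auto split: if_splits)
  finally show ?case
    using mult by (simp add: endpt_mult endpt_g g_in_Gt)
qed

lemma chain_one: "chain \<one>\<^bsub>\<Gamma>\<^esub> = {}"
  by (auto simp: chain_def Gt_one)

text \<open>Only component \<open>j\<close> of \<open>g j\<close> has a nonzero group algebra part,
  namely \<open>[0]\<close>. Multiplication moves it to the current vertex with the coordinate
  \<open>b j\<close> forgotten, and this names the edge just crossed in either direction.\<close>

lemma chain_mult_g:
  assumes "a \<in> carrier \<Gamma>" "j \<in> {1..m}"
  shows "chain (a \<otimes>\<^bsub>\<Gamma>\<^esub> g j) = symd (chain a) {(j, endpt a - {b j})}"
proof -
  have "fst ((a \<otimes>\<^bsub>\<Gamma>\<^esub> g j) x) = symd (fst (a x)) (if x = j then {endpt a - {b j}} else {})"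
    if "x \<in> {1..m}" for x
    using that assms snd_Gt[OF assms(1) that] by (simp add: Gt_mult g_apply)
  then have "(x, w) \<in> chain (a \<otimes>\<^bsub>\<Gamma>\<^esub> g j) \<longleftrightarrow> (x, w) \<in> symd (chain a) {(j, endpt a - {b j})}" for x w
    using assms(2) by (cases "x \<in> {1..m}") (auto simp: chain_def)
  then show ?thesis
    unfolding set_eq_iff split_paired_All by simp
qed

text \<open>The second chain is translated by the end point of the first walk; after a closed walk
  this translation is trivial.\<close>

lemma chain_mult_closed:
  assumes "a \<in> carrier \<Gamma>" "endpt a = {}"
  shows "chain (a \<otimes>\<^bsub>\<Gamma>\<^esub> c) = symd (chain a) (chain c)"
proof -
  have "fst ((a \<otimes>\<^bsub>\<Gamma>\<^esub> c) x) = symd (fst (a x)) (fst (c x))" if "x \<in> {1..m}" for x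
    using snd_Gt[OF assms(1) that] assms(2) that by (simp add: Gt_mult)
  then show ?thesis
    unfolding chain_def set_eq_iff by auto
qed

lemma chain_subset: "a \<in> carrier \<Gamma> \<Longrightarrow> chain a \<subseteq> edges"
  using Gt_component by (fastforce simp: chain_def edges_def)

lemma finite_edges: "finite edges"
  by (simp add: edges_def)

lemma finite_chain: "a \<in> carrier \<Gamma> \<Longrightarrow> finite (chain a)"
  using chain_subset finite_edges finite_subset by blast

text \<open>The chain holds the group algebra parts of all components, the end point the rest;
  together they are a faithful record.\<close>

lemma chain_endpt_inj:
  assumes "a \<in> carrier \<Gamma>" "c \<in> carrier \<Gamma>" "chain a = chain c" "endpt a = endpt c"
  shows "a = c"
proof (rule Gt_ext[OF assms(1,2)])
  fix x assume x: "x \<in> {1..m}"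
  have "fst (a x) = {w. (x, w) \<in> chain a}" "fst (c x) = {w. (x, w) \<in> chain c}"
    using x by (auto simp: chain_def)
  moreover have "snd (a x) = snd (c x)"
    using assms x by (simp add: snd_Gt)
  ultimately show "a x = c x"
    using assms(3) by (simp add: prod_eq_iff)
qed

lemma finite_Gt: "finite (carrier \<Gamma>)"
  using finite_subset[OF Gt_subset_Gprod] unfolding carrier_Gprod
  by (simp add: finite_PiE)

text \<open>On closed walks \<open>chain\<close> is additive and injective, with values in an F_2
  vector space.\<close>

lemma elem_ab2_closed_walks: "elem_ab2 \<Gamma> {a \<in> carrier \<Gamma>. endpt a = {}}"
proof -
  let ?K = "{a \<in> carrier \<Gamma>. endpt a = {}}"
  interpret group_hom \<Gamma> "Vgrp n" endpt
    using endpt_hom group_Gt group_Vgrp by (simp add: group_hom_def group_hom_axioms_def)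
  have "subgroup ?K \<Gamma>"
    using subgroup_kernel by (simp add: kernel_def)
  moreover have "a \<otimes>\<^bsub>\<Gamma>\<^esub> c = c \<otimes>\<^bsub>\<Gamma>\<^esub> a" if "a \<in> ?K" "c \<in> ?K" for a c
    using that by (intro chain_endpt_inj) (auto simp: chain_mult_closed endpt_mult)
  moreover have "a \<otimes>\<^bsub>\<Gamma>\<^esub> a = \<one>\<^bsub>\<Gamma>\<^esub>" if "a \<in> ?K" for a
    using that by (intro chain_endpt_inj) (auto simp: chain_mult_closed endpt_mult chain_one endpt_one)
  ultimately show ?thesis
    by (simp add: elem_ab2_def)
qed

lemma block_expansion_group_Gt: "block_expansion_group k n \<Gamma> (phit k n) g"
proof -
  \<comment> \<open>The preimage of the kernel of \<pi> consists of the closed walks; it contains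
    the kernel of \<open>phit k n\<close>.\<close>
  have K: "{a \<in> carrier \<Gamma>. phit k n a \<in> ker_pi k n} = {a \<in> carrier \<Gamma>. endpt a = {}}"
    by (auto simp: ker_pi_eq endpt_def phit_def)
  let ?N = "kernel \<Gamma> (Vgrp m) (phit k n)"
  have N: "?N \<subseteq> {a \<in> carrier \<Gamma>. endpt a = {}}"
    by (auto simp: kernel_def endpt_def)
  interpret group_hom \<Gamma> "Vgrp m" "phit k n"
    using phit_hom group_Gt group_Vgrp by (simp add: group_hom_def group_hom_axioms_def)
  have "elem_ab2 \<Gamma> ?N"
    using elem_ab2_closed_walks N subgroup_kernel unfolding elem_ab2_def by blast
  moreover have "derived \<Gamma> (carrier \<Gamma>) = ?N"
  proof
    show "derived \<Gamma> (carrier \<Gamma>) \<subseteq> ?N"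
      by (rule derived_subset_kernel[OF group_Gt phit_hom])
    show "?N \<subseteq> derived \<Gamma> (carrier \<Gamma>)"
      by (rule kernel_subset_derived[OF group_Gt phit_hom _ generate_Gt])
        (simp add: g_in_Gt phit_g g_square)
  qed
  ultimately show ?thesis
    unfolding block_expansion_group_def expansion_group_def K
    using group_Gt phit_hom g_in_Gt phit_g g_square elem_ab2_closed_walks by blast
qed

end

subsection \<open>Order and universal property\<close>

text \<open>Nonempty blocks allow a choice of an element over every vertex of F_2^n. Applied to
  \<open>Gt k n\<close> this gives paths that split the chain space; applied to an arbitrary G it
  turns edges into loops.\<close>

lemma exists_section:
  fixes G (structure)
  assumes grp: "group G" and hom: "\<phi> \<in> hom G (Vgrp (msum k n))"
    and h: "\<And>j. j \<in> {1..msum k n} \<Longrightarrow> h j \<in> carrier G \<and> \<phi> (h j) = {j}"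
    and pos: "\<forall>i\<in>{1..n}. 1 \<le> k i"
  obtains \<sigma> where "\<sigma> {} = \<one>"
    and "\<And>u. u \<subseteq> {1..n} \<Longrightarrow> \<sigma> u \<in> carrier G" and "\<And>u. u \<subseteq> {1..n} \<Longrightarrow> bpar k n (\<phi> (\<sigma> u)) = u"
proof -
  interpret group G by fact
  have gc: "generate G (h ` {1..msum k n}) \<subseteq> carrier G"
    using h by (intro generate_incl) auto
  have "\<exists>s\<in>carrier G. bpar k n (\<phi> s) = u" if u: "u \<subseteq> {1..n}" for u
  proof -
    \<comment> \<open>The least index of block \<open>i\<close>; one index per block suffices to
      realise any prescribed parities.\<close>
    define p where "p i = (\<Sum>l=1..<i. k l) + 1" for i
    have p: "p i \<in> block k i" if "i \<in> {1..n}" for i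
      using block_nonempty[of i k] pos that by (simp add: p_def)
    have "p ` u \<subseteq> {1..msum k n}"
      using p block_subset u by blast
    then obtain s where s: "s \<in> carrier G" "\<phi> s = p ` u"
      using exists_preimage_in_generate[OF grp hom h, of "p ` u"] gc by (metis subsetD)
    have "p ` u \<inter> block k i = (if i \<in> u then {p i} else {})" if "i \<in> {1..n}" for i
    proof -
      have "i' = i" if "i' \<in> u" "p i' \<in> block k i" for i'
        using p[of i'] u that block_unique by blast
      then show ?thesis
        using p[OF that] by auto
    qed
    then have "bpar k n (\<phi> s) = u"
      using u by (auto simp: bpar_def s split: if_splits)
    with s show ?thesis by blast
  qed
  then obtain \<sigma>' where \<sigma>': "\<And>u. u \<subseteq> {1..n} \<Longrightarrow> \<sigma>' u \<in> carrier G \<and> bpar k n (\<phi> (\<sigma>' u)) = u"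
    by metis
  \<comment> \<open>The value at the origin is reset to \<open>\<one>\<close>, so that the chosen
    path to the origin is trivial.\<close>
  show thesis
    by (rule that[of "\<lambda>u. if u = {} then \<one> else \<sigma>' u"])
      (use \<sigma>' hom_Vgrp_one[OF grp hom] in auto)
qed

section \<open>Boundary map, cycle space and the order of \<open>Gt k n\<close>\<close>

context blocks
begin

text \<open>The mod 2 boundary of an edge, the sum of its two ends; for a pair in
  \<open>edges\<close> these differ, since \<open>b x\<close> is not in \<open>w\<close>.\<close>

definition bd :: "nat \<times> nat set \<Rightarrow> nat set set" where
  "bd = (\<lambda>(x, w). {w, insert (b x) w})"

text \<open>Boundaries telescope: each further edge replaces the old end point by the new one, and
  the start \<open>{}\<close> stays.\<close>

lemma boundary_chain: "a \<in> carrier \<Gamma> \<Longrightarrow> lin bd (chain a) = symd {endpt a} {{}}"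
proof (induction rule: Gt_induct)
  case one
  then show ?case by (simp add: chain_one endpt_one)
next
  case (mult a j)
  let ?e = "endpt a"
  have pair: "symd {x} {y} = {x, y}" if "x \<noteq> y" for x y :: "nat set"
    using that by auto
  have "bd (j, ?e - {b j}) = {?e, symd ?e {b j}}"
  proof (cases "b j \<in> ?e")
    case True
    then have "symd ?e {b j} = ?e - {b j}" "insert (b j) ?e = ?e" by auto
    then show ?thesis by (auto simp: bd_def)
  next
    case False
    then have "symd ?e {b j} = insert (b j) ?e" "?e - {b j} = ?e" by auto
    then show ?thesis by (simp add: bd_def)
  qed
  also have "\<dots> = symd {?e} {symd ?e {b j}}"
    by (rule pair[symmetric]) (metis symd_cancel(1) symd_self insert_not_empty)
  finally have "lin bd (chain (a \<otimes>\<^bsub>\<Gamma>\<^esub> g j)) = symd (symd {?e} {{}}) (symd {?e} {symd ?e {b j}})"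
    using mult by (simp add: chain_mult_g lin_symd finite_chain)
  also have "\<dots> = symd {symd ?e {b j}} {{}}"
    by (simp only: symd_assoc symd_left_commute[of "{{}}"] symd_cancel) (rule symd_commute)
  finally show ?case
    using mult by (simp add: endpt_mult endpt_g g_in_Gt)
qed

lemma card_edges: "card edges = m * 2 ^ (n - 1)"
proof -
  have "card edges = (\<Sum>x\<in>{1..m}. card (Pow ({1..n} - {b x})))"
    unfolding edges_def by (rule card_SigmaI) auto
  also have "\<dots> = (\<Sum>x\<in>{1..m}. 2 ^ (n - 1))"
  proof (rule sum.cong)
    fix x assume "x \<in> {1..m}"
    then show "card (Pow ({1..n} - {b x})) = 2 ^ (n - 1)"
      using blk_in by (simp add: card_Pow)
  qed simp
  finally show ?thesis by simp
qed

text \<open>The walks \<open>\<sigma> u\<close> from 0 to u split the chain space into boundary and cycle parts.\<close>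

lemma card_Gt:
  assumes pos: "\<forall>i\<in>{1..n}. 1 \<le> k i"
  shows "card (carrier \<Gamma>) = 2 ^ (m * 2 ^ (n - 1) + n + 1 - 2 ^ n)"
proof -
  obtain \<sigma> where \<sigma>: "\<sigma> {} = \<one>\<^bsub>\<Gamma>\<^esub>" "\<And>u. u \<subseteq> {1..n} \<Longrightarrow> \<sigma> u \<in> carrier \<Gamma>"
      "\<And>u. u \<subseteq> {1..n} \<Longrightarrow> endpt (\<sigma> u) = u"
    using exists_section[OF group_Gt phit_hom, of g] pos g_in_Gt phit_g unfolding endpt_def by blast
  define K where "K = {a \<in> carrier \<Gamma>. endpt a = {}}"
  define P where "P u = chain (\<sigma> u)" for u
  have P0: "P {} = {}"
    by (simp add: P_def \<sigma> chain_one)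
  have Pfin: "finite (P u)" and Psub: "P u \<subseteq> edges" if "u \<subseteq> {1..n}" for u
    using that \<sigma> finite_chain chain_subset by (simp_all add: P_def)
  have Kfin: "finite K"
    using finite_Gt by (simp add: K_def)
  have K1: "\<one>\<^bsub>\<Gamma>\<^esub> \<in> K"
    by (simp add: K_def endpt_one)
  \<comment> \<open>Sets of vertices other than the origin: its path has zero chain, so admitting it
    would destroy the uniqueness of the decomposition.\<close>
  let ?C = "Pow (Pow {1..n} - {{}})"
  have finC: "finite c" if "c \<subseteq> Pow {1..n}" for c
    using that finite_subset by blast
  \<comment> \<open>The path to \<open>u\<close> has boundary \<open>u\<close> plus the origin. So,
    up to the origin, \<open>lin P\<close> is a right inverse of the boundary map.\<close>
  have linP_bd: "lin bd (lin P c) - {{}} = c - {{}}" if c: "c \<subseteq> Pow {1..n}" for c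
  proof -
    have "lin bd (lin P c) = lin (\<lambda>u. lin bd (P u)) c"
      using finC[OF c] Pfin c by (intro lin_lin) auto
    also have "\<dots> = lin (\<lambda>u. symd {u} {{}}) c"
    proof (rule lin_cong)
      fix u assume "u \<in> c"
      then have "u \<subseteq> {1..n}" using c by auto
      then show "lin bd (P u) = symd {u} {{}}"
        unfolding P_def using \<sigma> boundary_chain[of "\<sigma> u"] by simp
    qed
    also have "\<dots> - {{}} = c - {{}}"
    proof -
      have "{u \<in> c. z \<in> symd {u} {{}}} = (if z \<in> c then {z} else {})" if "z \<noteq> {}" for z
        using that by (auto split: if_splits)
      then have "z \<in> lin (\<lambda>u. symd {u} {{}}) c \<longleftrightarrow> z \<in> c" if "z \<noteq> {}" for z
        using that unfolding lin_def by (simp del: in_symd)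
      then show ?thesis by blast
    qed
    finally show ?thesis .
  qed
  \<comment> \<open>The chain space is the direct sum of the cycle space and the span of the chosen
    paths; comparing cardinalities yields the order of \<open>K\<close>.\<close>
  have bij1: "bij_betw (\<lambda>(c, a). symd (chain a) (lin P c)) (?C \<times> K) (Pow edges)"
  proof (rule bij_betw_imageI)
    show "inj_on (\<lambda>(c, a). symd (chain a) (lin P c)) (?C \<times> K)"
    proof (rule inj_onI)
      fix p p'
      assume p: "p \<in> ?C \<times> K" "p' \<in> ?C \<times> K"
        and peq: "(\<lambda>(c, a). symd (chain a) (lin P c)) p = (\<lambda>(c, a). symd (chain a) (lin P c)) p'"
      obtain c a c' a' where pp: "p = (c, a)" "p' = (c', a')"
        by (cases p, cases p') blast
      have ca: "c \<in> ?C" "a \<in> K" "c' \<in> ?C" "a' \<in> K"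
        and eq: "symd (chain a) (lin P c) = symd (chain a') (lin P c')"
        using p peq unfolding pp by auto
      \<comment> \<open>Closed walks have zero boundary, so the boundary sees only the part coming
        from \<open>c\<close>.\<close>
      have bdK: "lin bd (symd (chain a) (lin P c)) = lin bd (lin P c)" if "a \<in> K" "c \<in> ?C" for a c
      proof -
        have "finite (lin P c)"
          using that finC[of c] Pfin by (intro finite_lin) auto
        then show ?thesis
          using that boundary_chain[of a] by (simp add: K_def lin_symd finite_chain)
      qed
      have "lin bd (lin P c) = lin bd (lin P c')"
        using bdK ca eq by metis
      moreover have "c \<subseteq> Pow {1..n}" "c' \<subseteq> Pow {1..n}"
        using ca by auto
      ultimately have "c - {{}} = c' - {{}}"
        using linP_bd by metis
      then have c: "c = c'"
        using ca by auto
      then have "chain a = chain a'"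
        using eq by (metis symd_cancel(2))
      then show "p = p'"
        using c ca chain_endpt_inj by (auto simp: K_def pp)
    qed
    have sub: "symd (chain a) (lin P c) \<subseteq> edges" if "c \<in> ?C" "a \<in> K" for c a
    proof (intro symd_subset lin_subset)
      show "chain a \<subseteq> edges"
        using that chain_subset by (simp add: K_def)
      show "finite c"
        using that finC[of c] by blast
      show "P u \<subseteq> edges" if "u \<in> c" for u
        using that \<open>c \<in> ?C\<close> by (intro Psub) blast
    qed
    have "\<exists>c a. c \<subseteq> Pow {1..n} \<and> a \<in> K \<and> S = symd (chain a) (lin P c)" if S: "S \<subseteq> edges" for S
    proof -
      have "finite S"
        using S finite_edges finite_subset by blast
      then show ?thesis
        using S
      proof (induction S rule: finite_induct)
        case empty
        show ?case
          using K1 by (intro exI[of _ "{}"] exI[of _ "\<one>\<^bsub>\<Gamma>\<^esub>"]) (simp add: chain_one)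
      next
        case (insert e S)
        then obtain c a where ca: "c \<subseteq> Pow {1..n}" "a \<in> K" "S = symd (chain a) (lin P c)"
          by auto
        obtain x w where e: "e = (x, w)" "x \<in> {1..m}" "w \<subseteq> {1..n}" "b x \<notin> w"
          using insert.prems unfolding edges_def by blast
        define w' where "w' = insert (b x) w"
        have w': "w' \<subseteq> {1..n}" "symd w {b x} = w'" "w - {b x} = w"
          using e blk_in[OF e(2)] by (auto simp: w'_def)
        \<comment> \<open>The loop that follows the path to \<open>w\<close>, crosses
          \<open>e\<close> and returns along the path to \<open>w'\<close>. Its chain is
          \<open>e\<close> plus both paths, which writes \<open>e\<close> as a cycle plus
          paths.\<close>
        define q where "q = \<sigma> w \<otimes>\<^bsub>\<Gamma>\<^esub> g x \<otimes>\<^bsub>\<Gamma>\<^esub> inv\<^bsub>\<Gamma>\<^esub> \<sigma> w'"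
        note car = \<sigma>(2)[OF e(3)] \<sigma>(2)[OF w'(1)] g_in_Gt[OF e(2)]
        have qK: "q \<in> K"
          using car \<sigma>(3)[OF e(3)] \<sigma>(3)[OF w'(1)] w' endpt_g[OF e(2)]
            hom_Vgrp_inv[OF group_Gt endpt_hom car(2)]
          by (simp add: q_def K_def endpt_mult)
        have "q \<otimes>\<^bsub>\<Gamma>\<^esub> \<sigma> w' = \<sigma> w \<otimes>\<^bsub>\<Gamma>\<^esub> g x"
          using car by (simp add: q_def \<Gamma>.m_assoc)
        then have "symd (chain q) (P w') = symd (P w) {e}"
          using chain_mult_closed[of q "\<sigma> w'"] qK chain_mult_g[OF car(1) e(2)] \<sigma>(3)[OF e(3)] w' e(1)
          by (simp add: K_def P_def)
        then have "symd (P w) (symd (chain q) (P w')) = {e}"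
          by simp
        then have E: "{e} = symd (chain q) (symd (P w) (P w'))"
          by (simp only: symd_left_commute)
        have aq: "a \<otimes>\<^bsub>\<Gamma>\<^esub> q \<in> K" "chain (a \<otimes>\<^bsub>\<Gamma>\<^esub> q) = symd (chain a) (chain q)"
          using ca qK by (auto simp: K_def endpt_mult chain_mult_closed)
        let ?c = "symd c (symd {w} {w'})"
        have c: "?c \<subseteq> Pow {1..n}"
          using ca e w' by (intro symd_subset) auto
        have "lin P ?c = symd (lin P c) (symd (P w) (P w'))"
          using finC[OF ca(1)] by (simp add: lin_symd)
        then have "symd (chain (a \<otimes>\<^bsub>\<Gamma>\<^esub> q)) (lin P ?c) = symd S {e}"
          unfolding aq(2) ca(3) E by (simp only: symd_assoc symd_left_commute)
        then have "insert e S = symd (chain (a \<otimes>\<^bsub>\<Gamma>\<^esub> q)) (lin P ?c)"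
          using insert_eq_symd[OF insert.hyps(2)] by simp
        with c aq(1) show ?case by blast
      qed
    qed
    \<comment> \<open>The origin can be removed from \<open>c\<close>, because \<open>P {}\<close>
      is zero.\<close>
    moreover have "lin P (c - {{}}) = lin P c" for c
    proof -
      have "{u \<in> c - {{}}. e \<in> P u} = {u \<in> c. e \<in> P u}" for e
        using P0 by auto
      then show ?thesis by (simp add: lin_def)
    qed
    ultimately have ex: "\<exists>c a. c \<in> ?C \<and> a \<in> K \<and> S = symd (chain a) (lin P c)" if "S \<subseteq> edges" for S
      using that by (metis Diff_mono PowI order_refl)
    show "(\<lambda>(c, a). symd (chain a) (lin P c)) ` (?C \<times> K) = Pow edges"
    proof (intro equalityI subsetI)
      fix S assume "S \<in> (\<lambda>(c, a). symd (chain a) (lin P c)) ` (?C \<times> K)"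
      then show "S \<in> Pow edges"
        using sub by blast
    next
      fix S assume "S \<in> Pow edges"
      then obtain c a where "c \<in> ?C" "a \<in> K" "S = symd (chain a) (lin P c)"
        using ex by blast
      then show "S \<in> (\<lambda>(c, a). symd (chain a) (lin P c)) ` (?C \<times> K)"
        by (intro image_eqI[of _ _ "(c, a)"]) auto
    qed
  qed
  \<comment> \<open>The walks \<open>\<sigma> u\<close> represent the cosets of
    \<open>K\<close>.\<close>
  have bij2: "bij_betw (\<lambda>(u, a). a \<otimes>\<^bsub>\<Gamma>\<^esub> \<sigma> u) (Pow {1..n} \<times> K) (carrier \<Gamma>)"
  proof (rule bij_betw_imageI)
    have ep: "endpt (a \<otimes>\<^bsub>\<Gamma>\<^esub> \<sigma> u) = u" if "u \<subseteq> {1..n}" "a \<in> K" for u a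
      using that \<sigma> by (simp add: K_def endpt_mult)
    show "inj_on (\<lambda>(u, a). a \<otimes>\<^bsub>\<Gamma>\<^esub> \<sigma> u) (Pow {1..n} \<times> K)"
    proof (rule inj_onI)
      fix p p'
      assume p: "p \<in> Pow {1..n} \<times> K" "p' \<in> Pow {1..n} \<times> K"
        and peq: "(\<lambda>(u, a). a \<otimes>\<^bsub>\<Gamma>\<^esub> \<sigma> u) p = (\<lambda>(u, a). a \<otimes>\<^bsub>\<Gamma>\<^esub> \<sigma> u) p'"
      obtain u a u' a' where pp: "p = (u, a)" "p' = (u', a')"
        by (cases p, cases p') blast
      have ua: "u \<subseteq> {1..n}" "a \<in> K" "u' \<subseteq> {1..n}" "a' \<in> K"
        and eq: "a \<otimes>\<^bsub>\<Gamma>\<^esub> \<sigma> u = a' \<otimes>\<^bsub>\<Gamma>\<^esub> \<sigma> u'"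
        using p peq unfolding pp by auto
      have "u = u'"
        using ep ua eq by metis
      then show "p = p'"
        using eq ua \<sigma> by (simp add: K_def pp)
    qed
    show "(\<lambda>(u, a). a \<otimes>\<^bsub>\<Gamma>\<^esub> \<sigma> u) ` (Pow {1..n} \<times> K) = carrier \<Gamma>"
    proof (intro equalityI subsetI)
      fix y assume "y \<in> (\<lambda>(u, a). a \<otimes>\<^bsub>\<Gamma>\<^esub> \<sigma> u) ` (Pow {1..n} \<times> K)"
      then show "y \<in> carrier \<Gamma>"
        using \<sigma> by (auto simp: K_def)
    next
      fix y assume y: "y \<in> carrier \<Gamma>"
      let ?s = "\<sigma> (endpt y)"
      have s: "?s \<in> carrier \<Gamma>" "endpt ?s = endpt y"
        using \<sigma> endpt_subset by auto
      have "y \<otimes>\<^bsub>\<Gamma>\<^esub> inv\<^bsub>\<Gamma>\<^esub> ?s \<in> K"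
        using y s hom_Vgrp_inv[OF group_Gt endpt_hom s(1)] by (simp add: K_def endpt_mult)
      moreover have "y = (y \<otimes>\<^bsub>\<Gamma>\<^esub> inv\<^bsub>\<Gamma>\<^esub> ?s) \<otimes>\<^bsub>\<Gamma>\<^esub> ?s"
        using y s by (simp add: \<Gamma>.m_assoc)
      ultimately show "y \<in> (\<lambda>(u, a). a \<otimes>\<^bsub>\<Gamma>\<^esub> \<sigma> u) ` (Pow {1..n} \<times> K)"
        using endpt_subset by (intro image_eqI[of _ _ "(endpt y, y \<otimes>\<^bsub>\<Gamma>\<^esub> inv\<^bsub>\<Gamma>\<^esub> ?s)"]) auto
    qed
  qed
  have "card (Pow {1..n} - {{}}) = 2 ^ n - 1"
    by (simp add: card_Diff_singleton card_Pow)
  then have c1: "2 ^ (2 ^ n - 1) * card K = (2::nat) ^ (m * 2 ^ (n - 1))"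
    using bij_betw_same_card[OF bij1] card_edges finite_edges by (simp add: card_cartesian_product card_Pow)
  have c2: "2 ^ n * card K = card (carrier \<Gamma>)"
    using bij_betw_same_card[OF bij2] by (simp add: card_cartesian_product card_Pow)
  \<comment> \<open>The exponent in the claim is a difference of natural numbers. Since
    \<open>K\<close> is nonempty, \<open>c1\<close> bounds \<open>2 ^ n - 1\<close> by the number of
    edges, so nothing is truncated.\<close>
  have "1 \<le> card K"
    using K1 Kfin by (metis One_nat_def Suc_leI card_gt_0_iff empty_iff)
  then have "(2::nat) ^ (2 ^ n - 1) \<le> 2 ^ (m * 2 ^ (n - 1))"
    using c1 by (metis mult_le_mono2 mult.right_neutral)
  then have le: "2 ^ n - 1 \<le> m * 2 ^ (n - 1)"
    by (rule power_le_imp_le_exp[rotated]) simp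
  have "card (carrier \<Gamma>) * 2 ^ (2 ^ n - 1) = 2 ^ n * 2 ^ (m * 2 ^ (n - 1))"
    using c1 c2 by (metis mult.assoc mult.commute)
  also have "\<dots> = 2 ^ (m * 2 ^ (n - 1) + n + 1 - 2 ^ n) * 2 ^ (2 ^ n - 1)"
  proof -
    have "1 \<le> (2::nat) ^ n"
      by simp
    then have "m * 2 ^ (n - 1) + n + 1 - 2 ^ n + (2 ^ n - 1) = n + m * 2 ^ (n - 1)"
      using le by linarith
    then show ?thesis
      by (metis power_add)
  qed
  finally show ?thesis
    by simp
qed

text \<open>The image of a is the value of the walk of a in G: it is the product of the loops
  \<open>\<kappa> (x, w)\<close> over the edges of the walk, followed by the chosen path to its end point. As these loops
  lie in an elementary abelian 2-group, only the chain of the walk matters.\<close>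

lemma exists_expansion_hom:
  fixes G (structure)
  assumes beg: "block_expansion_group k n G \<phi> h" and pos: "\<forall>i\<in>{1..n}. 1 \<le> k i"
  obtains f where "expansion_hom m \<Gamma> g G h f"
proof -
  have grp: "group G" and hom: "\<phi> \<in> hom G (Vgrp m)"
    using beg by (auto simp: block_expansion_group_def expansion_group_def)
  have h: "h j \<in> carrier G" "\<phi> (h j) = {j}" "h j \<otimes> h j = \<one>" if "j \<in> {1..m}" for j
    using beg that by (auto simp: block_expansion_group_def expansion_group_def)
  interpret group G by fact
  \<comment> \<open>The composite of \<pi> and \<open>\<phi>\<close>: the vertex over which an
    element of G lies.\<close>
  define v where "v x = bpar k n (\<phi> x)" for x
  have vhom: "v \<in> hom G (Vgrp n)"
    unfolding v_def by (rule bpar_hom[OF hom])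
  have vm: "v (x \<otimes> y) = symd (v x) (v y)" if "x \<in> carrier G" "y \<in> carrier G" for x y
    using hom_mult[OF vhom that] by simp
  have vi: "v (inv x) = v x" if "x \<in> carrier G" for x
    using hom_Vgrp_inv[OF grp vhom that] .
  have vh: "v (h j) = {b j}" if "j \<in> {1..m}" for j
    using h(2)[OF that] bpar_singleton[OF that] by (simp add: v_def)
  define K where "K = {x \<in> carrier G. v x = {}}"
  have "{x \<in> carrier G. \<phi> x \<in> ker_pi k n} = K"
    using hom_in_carrier[OF hom] by (auto simp: ker_pi_eq K_def v_def)
  then have K: "elem_ab2 G K"
    using beg by (simp add: block_expansion_group_def)
  have subK: "subgroup K G" and Ksq: "\<And>x. x \<in> K \<Longrightarrow> x \<otimes> x = \<one>"
    using K by (auto simp: elem_ab2_def)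
  let ?K = "G\<lparr>carrier := K\<rparr>"
  have "comm_group ?K"
    using K subgroup.subgroup_is_group[OF subK grp]
    by (intro group.group_comm_groupI) (auto simp: elem_ab2_def)
  then interpret K: comm_group ?K .
  obtain \<sigma> where \<sigma>: "\<sigma> {} = \<one>" "\<And>u. u \<subseteq> {1..n} \<Longrightarrow> \<sigma> u \<in> carrier G"
      "\<And>u. u \<subseteq> {1..n} \<Longrightarrow> v (\<sigma> u) = u"
    using exists_section[OF grp hom, of h] pos h unfolding v_def by blast
  \<comment> \<open>The loop at the origin that runs to \<open>w\<close>, crosses the edge of colour
    \<open>x\<close> and returns from its other end.\<close>
  define \<kappa> where "\<kappa> = (\<lambda>(x, w). \<sigma> w \<otimes> h x \<otimes> inv \<sigma> (symd w {b x}))"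
  have \<kappa>K: "\<kappa> (x, w) \<in> K" if "x \<in> {1..m}" "w \<subseteq> {1..n}" for x w
  proof -
    have "symd w {b x} \<subseteq> {1..n}"
      using that blk_in[OF that(1)] by (intro symd_subset) auto
    then show ?thesis
      using that h \<sigma> by (simp add: \<kappa>_def K_def vm vi vh)
  qed
  \<comment> \<open>Crossing an edge backwards inverts its loop, and elements of \<open>K\<close>
    are their own inverses; hence the loop depends only on the undirected edge.\<close>
  have \<kappa>rev: "\<kappa> (x, symd w {b x}) = \<kappa> (x, w)" if "x \<in> {1..m}" "w \<subseteq> {1..n}" for x w
  proof -
    let ?w = "symd w {b x}"
    have w: "?w \<subseteq> {1..n}"
      using that blk_in[OF that(1)] by (intro symd_subset) auto
    have "inv (h x) = h x"
      using h[OF that(1)] by (metis inv_equality)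
    then have "\<kappa> (x, ?w) = inv (\<kappa> (x, w))"
      using that w h \<sigma> by (simp add: \<kappa>_def inv_mult_group m_assoc)
    also have "\<dots> = \<kappa> (x, w)"
      using Ksq[OF \<kappa>K[OF that]] \<kappa>K[OF that] by (intro inv_equality) (auto simp: K_def)
    finally show ?thesis .
  qed
  have \<kappa>edge: "\<kappa> (x, w - {b x}) = \<kappa> (x, w)" if "x \<in> {1..m}" "w \<subseteq> {1..n}" for x w
  proof (cases "b x \<in> w")
    case True
    then have "w - {b x} = symd w {b x}" by auto
    then show ?thesis using \<kappa>rev[OF that] by simp
  qed simp
  define f where "f a = finprod ?K \<kappa> (chain a) \<otimes> \<sigma> (endpt a)" for a
  have \<kappa>fun: "\<kappa> \<in> edges \<rightarrow> K"
  proof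
    fix e assume "e \<in> edges"
    then obtain x w where "e = (x, w)" "x \<in> {1..m}" "w \<subseteq> {1..n}"
      unfolding edges_def by blast
    then show "\<kappa> e \<in> K"
      using \<kappa>K by simp
  qed
  have prodK: "finprod ?K \<kappa> (chain a) \<in> K" if "a \<in> carrier \<Gamma>" for a
  proof -
    have "\<kappa> \<in> chain a \<rightarrow> carrier ?K"
      using \<kappa>fun chain_subset[OF that] by auto
    from K.finprod_closed[OF this] show ?thesis by simp
  qed
  have fc: "f a \<in> carrier G" if "a \<in> carrier \<Gamma>" for a
    using prodK[OF that] \<sigma>(2)[OF endpt_subset] by (simp add: f_def K_def)
  have f1: "f \<one>\<^bsub>\<Gamma>\<^esub> = \<one>"
    using \<sigma> by (simp add: f_def chain_one endpt_one)
  have fg: "f (a \<otimes>\<^bsub>\<Gamma>\<^esub> g j) = f a \<otimes> h j" if a: "a \<in> carrier \<Gamma>" and j: "j \<in> {1..m}" for a j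
  proof -
    let ?e = "(j, endpt a - {b j})" and ?Q = "finprod ?K \<kappa> (chain a)"
    have eE: "?e \<in> edges"
      using j endpt_subset[of a] by (auto simp: edges_def)
    have "finprod ?K \<kappa> (symd (chain a) {?e}) = ?Q \<otimes>\<^bsub>?K\<^esub> \<kappa> ?e"
    proof (rule K.finprod_symd_singleton)
      show "finite (chain a)"
        by (rule finite_chain[OF a])
      show "\<kappa> \<in> insert ?e (chain a) \<rightarrow> carrier ?K"
        using \<kappa>fun chain_subset[OF a] eE by auto
      show "\<kappa> ?e \<otimes>\<^bsub>?K\<^esub> \<kappa> ?e = \<one>\<^bsub>?K\<^esub>"
        using Ksq \<kappa>fun eE by auto
    qed
    then have 1: "finprod ?K \<kappa> (chain (a \<otimes>\<^bsub>\<Gamma>\<^esub> g j)) = ?Q \<otimes> \<kappa> (j, endpt a)"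
      using a j \<kappa>edge[OF j endpt_subset] by (simp add: chain_mult_g)
    have 2: "endpt (a \<otimes>\<^bsub>\<Gamma>\<^esub> g j) = symd (endpt a) {b j}"
      using a j by (simp add: endpt_mult endpt_g g_in_Gt)
    have "?Q \<in> carrier G" "\<sigma> (endpt a) \<in> carrier G" "\<sigma> (symd (endpt a) {b j}) \<in> carrier G"
      using prodK[OF a] \<sigma>(2) endpt_subset 2[symmetric] by (auto simp: K_def)
    \<comment> \<open>The return path inside \<open>\<kappa>\<close> cancels against the new
      \<open>\<sigma>\<close>, leaving \<open>\<sigma> (endpt a)\<close> followed by
      \<open>h j\<close>.\<close>
    then show ?thesis
      using h(1)[OF j] by (simp add: f_def 1 2) (simp add: \<kappa>_def m_assoc)
  qed
  \<comment> \<open>Induction on the second factor \<open>c\<close>, so that \<open>fg\<close>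
    handles the last letter of the product.\<close>
  have fm: "f (a \<otimes>\<^bsub>\<Gamma>\<^esub> c) = f a \<otimes> f c" if c: "c \<in> carrier \<Gamma>" and a: "a \<in> carrier \<Gamma>" for a c
    using c
  proof (induction rule: Gt_induct)
    case one
    then show ?case using a fc f1 by simp
  next
    case (mult c j)
    then have "f (a \<otimes>\<^bsub>\<Gamma>\<^esub> (c \<otimes>\<^bsub>\<Gamma>\<^esub> g j)) = f (a \<otimes>\<^bsub>\<Gamma>\<^esub> c) \<otimes> h j"
      using a g_in_Gt fg[of "a \<otimes>\<^bsub>\<Gamma>\<^esub> c" j] by (simp add: \<Gamma>.m_assoc)
    then show ?case
      using mult a fc fg h by (simp add: m_assoc)
  qed
  have "f (g j) = h j" if "j \<in> {1..m}" for j
    using fg[OF \<Gamma>.one_closed that] f1 h(1)[OF that] g_in_Gt[OF that] by simp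
  then have "expansion_hom m \<Gamma> g G h f"
    using fc fm by (auto simp: expansion_hom_def hom_def)
  then show thesis ..
qed

section \<open>Uniqueness and surjectivity of the homomorphism\<close>

lemma expansion_hom_unique:
  assumes "group G" "expansion_hom m \<Gamma> g G h f" "expansion_hom m \<Gamma> g G h f'" "a \<in> carrier \<Gamma>"
  shows "f' a = f a"
proof -
  have hom: "f \<in> hom \<Gamma> G" "f' \<in> hom \<Gamma> G"
    and g: "\<And>j. j \<in> {1..m} \<Longrightarrow> f (g j) = h j" "\<And>j. j \<in> {1..m} \<Longrightarrow> f' (g j) = h j"
    using assms by (auto simp: expansion_hom_def)
  show ?thesis
    using assms(4)
  proof (induction rule: Gt_induct)
    case one
    then show ?case
      using hom_one[OF hom(1) group_Gt assms(1)] hom_one[OF hom(2) group_Gt assms(1)] by simp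
  next
    case (mult a j)
    then show ?case
      using hom_mult[OF hom(1)] hom_mult[OF hom(2)] g g_in_Gt by simp
  qed
qed

text \<open>The image is a subgroup containing the \<open>h j\<close>, and these generate G.\<close>

lemma expansion_hom_surj:
  assumes beg: "block_expansion_group k n G \<phi> h" and f: "expansion_hom m \<Gamma> g G h f"
  shows "f ` carrier \<Gamma> = carrier G"
proof -
  have eg: "expansion_group m G \<phi> h"
    using beg by (simp add: block_expansion_group_def)
  then have grp: "group G"
    by (simp add: expansion_group_def)
  interpret group_hom \<Gamma> G f
    using f group_Gt grp by (simp add: group_hom_def group_hom_axioms_def expansion_hom_def)
  have "h ` {1..m} \<subseteq> f ` carrier \<Gamma>"
    using f g_in_Gt by (force simp: expansion_hom_def image_iff)
  then have "carrier G \<subseteq> f ` carrier \<Gamma>"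
    using expansion_group_generated[OF eg] H.generate_subgroup_incl[OF _ img_is_subgroup] by blast
  then show ?thesis
    by auto
qed

end

theorem theorem3p20:
  fixes n :: nat and k :: "nat \<Rightarrow> nat"
    and G :: "('g, 'c) monoid_scheme" and \<phi> :: "'g \<Rightarrow> nat set" and h :: "nat \<Rightarrow> 'g"
  assumes "\<forall>i\<in>{1..n}. 1 \<le> k i"
  shows "block_expansion_group k n (Gt k n) (phit k n) (gt k n) \<and>
    (block_expansion_group k n G \<phi> h \<longrightarrow>
      (\<exists>f. expansion_hom (msum k n) (Gt k n) (gt k n) G h f
           \<and> f ` carrier (Gt k n) = carrier G
           \<and> (\<forall>f'. expansion_hom (msum k n) (Gt k n) (gt k n) G h f'
                    \<and> f' ` carrier (Gt k n) = carrier G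
                   \<longrightarrow> (\<forall>x\<in>carrier (Gt k n). f' x = f x))
           \<and> finite (carrier G)
           \<and> card (carrier G) \<le> 2 ^ (msum k n * 2 ^ (n - 1) + n + 1 - 2 ^ n)
           \<and> (card (carrier G) = 2 ^ (msum k n * 2 ^ (n - 1) + n + 1 - 2 ^ n)
                \<longleftrightarrow> f \<in> iso (Gt k n) G)))"
proof (intro conjI impI)
  interpret blocks k n .
  show "block_expansion_group k n (Gt k n) (phit k n) (gt k n)"
    by (rule block_expansion_group_Gt)
  assume beg: "block_expansion_group k n G \<phi> h"
  then have grp: "group G"
    by (simp add: block_expansion_group_def expansion_group_def)
  obtain f where f: "expansion_hom (msum k n) (Gt k n) (gt k n) G h f"
    using exists_expansion_hom[OF beg assms] .
  have surj: "f ` carrier (Gt k n) = carrier G"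
    by (rule expansion_hom_surj[OF beg f])
  have uniq: "f' x = f x"
    if "expansion_hom (msum k n) (Gt k n) (gt k n) G h f'" "x \<in> carrier (Gt k n)" for f' x
    using expansion_hom_unique[OF grp f that] .
  have fin: "finite (carrier G)"
    using surj finite_Gt by (metis finite_imageI)
  have le: "card (carrier G) \<le> card (carrier (Gt k n))"
    using surj finite_Gt by (metis card_image_le)
  \<comment> \<open>A surjection from a finite set preserves cardinality exactly when it is
    injective; this settles the case of equality.\<close>
  have "card (carrier G) = card (carrier (Gt k n)) \<longleftrightarrow> inj_on f (carrier (Gt k n))"
    using surj finite_Gt by (metis card_image eq_card_imp_inj_on)
  also have "\<dots> \<longleftrightarrow> f \<in> iso (Gt k n) G"
    using surj f by (auto simp: iso_def bij_betw_def expansion_hom_def)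
  finally show "\<exists>f. expansion_hom (msum k n) (Gt k n) (gt k n) G h f
           \<and> f ` carrier (Gt k n) = carrier G
           \<and> (\<forall>f'. expansion_hom (msum k n) (Gt k n) (gt k n) G h f'
                    \<and> f' ` carrier (Gt k n) = carrier G
                   \<longrightarrow> (\<forall>x\<in>carrier (Gt k n). f' x = f x))
           \<and> finite (carrier G)
           \<and> card (carrier G) \<le> 2 ^ (msum k n * 2 ^ (n - 1) + n + 1 - 2 ^ n)
           \<and> (card (carrier G) = 2 ^ (msum k n * 2 ^ (n - 1) + n + 1 - 2 ^ n)
                \<longleftrightarrow> f \<in> iso (Gt k n) G)"
    using f surj uniq fin le unfolding card_Gt[OF assms] by blast
qed

end
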